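(* Let $m_{\pm}^{(n)}$ ($n\ge 1$) and $m_{\pm}$ be Herglotz functions, and write $H_n$ for the pair $(m_+^{(n)},m_-^{(n)})$ and $H$ for the pair $(m_+,m_-)$. If $m^{(n)}_{+}(z)\to m_{+}(z)$ and $m^{(n)}_{-}(z)\to m_{-}(z)$ locally uniformly on $z\in\mathbb C^+$, then the reflection coefficients satisfy \[ |R(x;H)| \le \limsup_{n\to\infty} |R(x;H_n)| \] for (Lebesgue) almost every $x\in\mathbb R$. In particular, if $A$ denotes the set of $x\in\mathbb R$ where the $\limsup$ is $<1$, then $\Sigma_{ac}(H)\supset A$ (up to a set of Lebesgue measure zero).
   Context: $\mathbb C^+=\{z\in\mathbb C:\operatorname{Im} z>0\}$. A Herglotz function is a holomorphic map $F:\mathbb C^+\to\mathbb C^+$; its boundary value $F(x)=\lim_{y\to0+}F(x+iy)$ exists for almost every $x\in\mathbb R$. For a pair $H=(m_+,m_-)$ of Herglotz functions, the generalized reflection coefficients are \[ R_+ = \frac{\overline{m_+}+m_-}{m_++m_-},\qquad R_- = \frac{m_++\overline{m_-}}{m_++m_-}, \] defined on $\mathbb C^+$ and, using boundary values, almost everywhere on $\mathbb R$ (the boundary value of the Herglotz function $m_++m_-$ is nonzero almost everywhere). Since $|R_+|=|R_-|$, one writes $|R|$, or $|R(x;H)|$ to display the dependence on the pair, for this common absolute value. Moreover, $\Sigma_{ac}(H)=\{x\in\mathbb R:\operatorname{Im} m_+(x)>0 \text{ and } \operatorname{Im} m_-(x)>0\}$, defined up to sets of Lebesgue measure zero. *)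

theory Defs
  imports "HOL-Complex_Analysis.Complex_Analysis"
begin

definition upper_half_plane :: "complex set" where
  "upper_half_plane = {z. Im z > 0}"

definition Herglotz :: "(complex \<Rightarrow> complex) \<Rightarrow> bool" where
  "Herglotz F \<longleftrightarrow>
     F holomorphic_on upper_half_plane \<and> F ` upper_half_plane \<subseteq> upper_half_plane"

text \<open>
  The boundary value \<open>lim F(x + i y)\<close> as \<open>y\<close> tends to \<open>0\<close> from above. For Herglotz \<open>F\<close> the limit
  exists for almost every \<open>x\<close>; on the exceptional null set \<open>Lim\<close> returns an unspecified value.
\<close>
definition boundary_value :: "(complex \<Rightarrow> complex) \<Rightarrow> real \<Rightarrow> complex" where
  "boundary_value F x = Lim (at_right 0) (\<lambda>y. F (Complex x y))"

text \<open>
  The argument type is generic, so that the same formula gives the reflection coefficients on the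
  upper half plane (applied to \<open>m\<^sub>+\<close>, \<open>m\<^sub>-\<close>) and on the real line (applied to their boundary values).
\<close>
definition R_plus :: "('a \<Rightarrow> complex) \<Rightarrow> ('a \<Rightarrow> complex) \<Rightarrow> 'a \<Rightarrow> complex" where
  "R_plus mp mm z = (cnj (mp z) + mm z) / (mp z + mm z)"

definition R_minus :: "('a \<Rightarrow> complex) \<Rightarrow> ('a \<Rightarrow> complex) \<Rightarrow> 'a \<Rightarrow> complex" where
  "R_minus mp mm z = (mp z + cnj (mm z)) / (mp z + mm z)"

lemma norm_R_plus_eq_norm_R_minus: "norm (R_plus mp mm z) = norm (R_minus mp mm z)"
proof -
  have "cnj (mp z) + mm z = cnj (mp z + cnj (mm z))" by simp
  then show ?thesis
    unfolding R_plus_def R_minus_def norm_divide by (metis complex_mod_cnj)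
qed

text \<open>\<open>|R(x;H)|\<close> for real \<open>x\<close> and a pair \<open>H = (m\<^sub>+, m\<^sub>-)\<close>; by the lemma above \<open>R_minus\<close> gives the same.\<close>
definition abs_R :: "real \<Rightarrow> (complex \<Rightarrow> complex) \<times> (complex \<Rightarrow> complex) \<Rightarrow> real" where
  "abs_R x H = norm (R_plus (boundary_value (fst H)) (boundary_value (snd H)) x)"

definition Sigma_ac :: "(complex \<Rightarrow> complex) \<times> (complex \<Rightarrow> complex) \<Rightarrow> real set" where
  "Sigma_ac H = {x. Im (boundary_value (fst H) x) > 0 \<and> Im (boundary_value (snd H) x) > 0}"

text \<open>
  Stated with compact subsets; on a locally compact (in particular, open) \<open>S\<close> this is the same as
  uniform convergence near each point of \<open>S\<close>.
\<close>
definition locally_uniform_limit ::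
    "complex set \<Rightarrow> (nat \<Rightarrow> complex \<Rightarrow> complex) \<Rightarrow> (complex \<Rightarrow> complex) \<Rightarrow> bool" where
  "locally_uniform_limit S f g \<longleftrightarrow>
     (\<forall>K. compact K \<longrightarrow> K \<subseteq> S \<longrightarrow> uniform_limit K f g sequentially)"

end

theory Submission
  imports Defs
begin

text \<open>
For \<open>p\<close>, \<open>q\<close> in the upper half plane, \<open>|cnj p + q| / |p + q|\<close> is the pseudo-hyperbolic distance between
the points \<open>q\<close> and \<open>- cnj p\<close>. The proof rests on the fact that the bounded function
\<open>u(z) = (2 / pi) * arcsin |R(z)|\<close> is subharmonic on the upper half plane for every pair of Herglotz
functions. Geometrically, \<open>u\<close> is the total variation distance between the harmonic measures on the
real line of the points \<open>m\<^sub>-(z)\<close> and \<open>- cnj (m\<^sub>+(z))\<close>: it is the supremum over intervals \<open>S\<close> of the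
differences of the two harmonic measures of \<open>S\<close>, and each such difference is a harmonic function of \<open>z\<close>.
By the invariance of \<open>|R|\<close> under SL(2,R) it suffices to treat a half line, where the harmonic measure is
an argument divided by \<open>pi\<close>; this is \<open>arg_sum_le_arcsin_refl_mod\<close>, with equality on the diagonal. So
\<open>u\<close> has, at each point, a harmonic minorant that is attained there
(\<open>harmonically_supported_refl_angle\<close>).

A bounded subharmonic function lies below the Poisson integral of its boundary values. Hence, if
\<open>u\<^sub>n\<close> belongs to \<open>H\<^sub>n\<close>, then \<open>u\<^sub>n(x + i y)\<close> is at most a Poisson average of the boundary values of \<open>u\<^sub>n\<close>,
which are at most their supremum over \<open>n \<ge> N\<close>. The left side converges to \<open>u(x + i y)\<close> since the
convergence of the Herglotz functions is pointwise inside the half plane, and \<open>y\<close> can then be sent to \<open>0\<close>.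
The estimate is integrated over an interval of \<open>x\<close>: after Fubini's theorem the Poisson average becomes an
average of shifts, which move the integral over an interval by an error that vanishes with \<open>y\<close>, uniformly
in \<open>n\<close> (\<open>interval_estimate_interior\<close>). This gives \<open>u(x) \<le> sup {u\<^sub>n(x) | n \<ge> N}\<close> for almost every \<open>x\<close>, all
\<open>N\<close>, and the first claim follows because \<open>arcsin\<close> is increasing. The second claim is the identity
\<open>1 - |R|\<^sup>2 = 4 Im m\<^sub>+ Im m\<^sub>- / |m\<^sub>+ + m\<^sub>-|\<^sup>2\<close> on the boundary.

The existence of boundary values is Fatou's theorem. For a Herglotz function \<open>m\<close> the bounded function
\<open>1 / (m + i)\<close> has a Lipschitz primitive, which extends to the closed half plane and is differentiable at
almost every real point; at such a point Cauchy's formula on a disc mapped conformally onto the half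
plane identifies the vertical limit with the derivative. The limit of \<open>1 / (m + i)\<close> vanishes only on a
null set: this is the comparison of boundary values once more, now for the subharmonic functions
\<open>max 0 (1 - ln |m + i| / n)\<close>, which tend to \<open>1\<close> inside but vanish wherever \<open>m\<close> has the boundary
value \<open>\<infinity>\<close>.
\<close>

section \<open>The reflection modulus and the action of SL(2,R)\<close>

text \<open>
The pseudo-hyperbolic distance of \<open>q\<close> and \<open>- cnj p\<close>. On boundary values it is the modulus of the
reflection coefficient.
\<close>

definition refl_mod :: "complex \<Rightarrow> complex \<Rightarrow> real" where
  "refl_mod p q = cmod (cnj p + q) / cmod (p + q)"

lemma refl_mod_defect:
  assumes "p + q \<noteq> 0"
  shows "1 - (refl_mod p q)\<^sup>2 = 4 * Im p * Im q / (cmod (p + q))\<^sup>2"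
proof -
  have "(cmod (p + q))\<^sup>2 - (cmod (cnj p + q))\<^sup>2 = 4 * Im p * Im q"
    unfolding cmod_power2 by (simp add: power2_eq_square algebra_simps)
  moreover have "1 - (refl_mod p q)\<^sup>2
      = ((cmod (p + q))\<^sup>2 - (cmod (cnj p + q))\<^sup>2) / (cmod (p + q))\<^sup>2"
    using assms by (simp add: refl_mod_def power_divide field_simps)
  ultimately show ?thesis by metis
qed

lemma refl_mod_nonneg: "0 \<le> refl_mod p q"
  by (simp add: refl_mod_def)

lemma refl_mod_le_1:
  assumes "p + q \<noteq> 0" "0 \<le> Im p" "0 \<le> Im q"
  shows "refl_mod p q \<le> 1"
proof -
  have "0 \<le> 1 - (refl_mod p q)\<^sup>2"
    unfolding refl_mod_defect[OF assms(1)] using assms by simp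
  then show ?thesis
    by (metis abs_le_square_iff abs_of_nonneg abs_one diff_ge_0_iff_ge one_power2 refl_mod_nonneg)
qed

lemma Im_moebius:
  fixes a b c d :: real and z :: complex
  assumes "c * z + d \<noteq> (0::complex)"
  shows "Im ((a * z + b) / (c * z + d)) = (a * d - b * c) * Im z / (cmod (c * z + d))\<^sup>2"
  unfolding cmod_power2 Im_divide by (simp add: power2_eq_square algebra_simps)

lemma moebius_denom_nz:
  fixes c d :: real and z :: complex
  assumes "Im z > 0" "c \<noteq> 0 \<or> d \<noteq> 0"
  shows "c * z + d \<noteq> (0::complex)"
  using assms by (auto simp: complex_eq_iff)

text \<open>
A real Moebius map \<open>g\<close> applied to both \<open>q\<close> and \<open>- cnj p\<close> preserves their hyperbolic distance. In terms of
\<open>p\<close>, the second application reads \<open>p \<mapsto> - g (- p)\<close>, which is the first fraction below.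
\<close>

lemma refl_mod_moebius:
  fixes a b c d :: real and p q :: complex
  assumes det: "a * d - b * c > 0" and p: "Im p > 0" and q: "Im q > 0"
  shows "refl_mod ((a * p - b) / (d - c * p)) ((a * q + b) / (c * q + d)) = refl_mod p q"
proof -
  have cd: "c \<noteq> 0 \<or> d \<noteq> 0" using det by auto
  have nq: "c * q + d \<noteq> 0" using moebius_denom_nz[OF q cd] .
  have np: "d - c * p \<noteq> 0" using moebius_denom_nz[OF p, of "-c" d] cd by simp
  have npc: "d - c * cnj p \<noteq> 0"
    using np by (metis complex_cnj_complex_of_real complex_cnj_diff complex_cnj_mult complex_cnj_zero_iff complex_cnj_cnj)
  have s: "(a * p - b) / (d - c * p) + (a * q + b) / (c * q + d)
      = (a * d - b * c) * (p + q) / ((d - c * p) * (c * q + d))"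
    using nq np by (simp add: field_simps)
  have t: "cnj ((a * p - b) / (d - c * p)) + (a * q + b) / (c * q + d)
      = (a * d - b * c) * (cnj p + q) / ((d - c * cnj p) * (c * q + d))"
    using nq npc by (simp add: field_simps)
  have "cmod (d - c * cnj p) = cmod (d - c * p)"
    by (metis complex_cnj_complex_of_real complex_cnj_diff complex_cnj_mult complex_mod_cnj)
  then show ?thesis
    unfolding refl_mod_def s t using nq np det
    by (simp add: norm_mult norm_divide flip: of_real_mult of_real_diff)
qed

text \<open>
Some hyperbolic isometry moves the midpoint of \<open>q\<close> and \<open>- cnj p\<close> to the imaginary axis and turns the
geodesic through them so that it crosses the axis at a right angle. The two images are then mirror images
of each other in the imaginary axis, that is, \<open>p\<close> and \<open>q\<close> get the same image.
\<close>

lemma moebius_normalise: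
  fixes p q :: complex
  assumes p: "Im p > 0" and q: "Im q > 0"
  obtains a b c d :: real
  where "a * d - b * c > 0" "(a * p - b) / (d - c * p) = (a * q + b) / (c * q + d)"
proof (cases "Im p = Im q")
  case True
  define s where "s = (Re p - Re q) / 2"
  show ?thesis
  proof (rule that[of 1 1 s 0])
    show "(complex_of_real 1 * p - complex_of_real s) / (complex_of_real 1 - complex_of_real 0 * p) =
      (complex_of_real 1 * q + complex_of_real s) / (complex_of_real 0 * q + complex_of_real 1)"
      using True by (simp add: complex_eq_iff s_def field_simps)
  qed simp
next
  case False
  define s where "s = (Re p - Re q) / 2"
  define x y1 y2 where "x = (Re p + Re q) / 2" and "y1 = Im p" and "y2 = Im q"
  have y: "y1 > 0" "y2 > 0" "y1 \<noteq> y2" using p q False by (auto simp: y1_def y2_def)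
  \<comment> \<open>After the translation by \<open>s\<close> the points are \<open>x + i y1\<close> and \<open>x + i y2\<close>. The map \<open>z \<mapsto> (z + b) / (z + d)\<close> and
    its companion give them the same image iff \<open>b * d = P\<close> and \<open>b + d = 2 * S\<close>, so \<open>b\<close> and \<open>d\<close> are the roots
    of a quadratic equation, and its discriminant is positive.\<close>
  define S P where "S = x * (y1 + y2) / (y2 - y1)" and "P = x\<^sup>2 - y1 * y2"
  have "S\<^sup>2 - P = x\<^sup>2 * (4 * y1 * y2 / (y2 - y1)\<^sup>2) + y1 * y2"
  proof -
    have "S\<^sup>2 * (y2 - y1)\<^sup>2 = x\<^sup>2 * (y1 + y2)\<^sup>2"
      using y by (simp add: S_def power_mult_distrib power_divide)
    also have "\<dots> = x\<^sup>2 * (y2 - y1)\<^sup>2 + x\<^sup>2 * (4 * y1 * y2)"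
      by (simp add: power2_eq_square algebra_simps)
    finally have "S\<^sup>2 = (x\<^sup>2 * (y2 - y1)\<^sup>2 + x\<^sup>2 * (4 * y1 * y2)) / (y2 - y1)\<^sup>2"
      using y by (simp add: eq_divide_eq)
    also have "\<dots> = x\<^sup>2 + x\<^sup>2 * (4 * y1 * y2 / (y2 - y1)\<^sup>2)"
      using y by (simp add: add_divide_distrib)
    finally show ?thesis by (simp add: P_def)
  qed
  moreover have "x\<^sup>2 * (4 * y1 * y2 / (y2 - y1)\<^sup>2) \<ge> 0" using y by simp
  ultimately have pos: "S\<^sup>2 - P > 0" using y by (simp add: add_nonneg_pos)
  define r where "r = sqrt (S\<^sup>2 - P)"
  have r: "r > 0" "r\<^sup>2 = S\<^sup>2 - P" using pos by (auto simp: r_def)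
  define d b where "d = S + r" and "b = S - r"
  have db: "d * b = P" using r(2) by (simp add: d_def b_def power2_eq_square algebra_simps)
  have ds: "d + b = 2 * S" by (simp add: d_def b_def)
  have p': "p - s = Complex x y1" and q': "q + s = Complex x y2"
    by (auto simp: complex_eq_iff s_def x_def y1_def y2_def field_simps)
  have nd1: "d - Complex x y1 \<noteq> 0" and nd2: "Complex x y2 + d \<noteq> 0"
    using y by (auto simp: complex_eq_iff)
  have e: "(d + b) * (y2 - y1) = 2 * x * (y1 + y2)" using y ds by (simp add: S_def)
  have key: "(Complex x y1 - b) * (Complex x y2 + d) = (Complex x y2 + b) * (d - Complex x y1)"
    using e db by (simp add: complex_eq_iff P_def power2_eq_square algebra_simps)
  show ?thesis
  proof (rule that[of 1 "s + d" "s + b" 1])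
    show "1 * (s + d) - (s + b) * 1 > 0" using r(1) by (simp add: d_def b_def)
    have pe: "p = Complex x y1 + of_real s" and qe: "q = Complex x y2 - of_real s"
      using p' q' by (auto simp: algebra_simps)
    have 1: "complex_of_real 1 * p - complex_of_real (s + b) = Complex x y1 - b"
        "complex_of_real (s + d) - complex_of_real 1 * p = d - Complex x y1"
      and 2: "complex_of_real 1 * q + complex_of_real (s + b) = Complex x y2 + b"
        "complex_of_real 1 * q + complex_of_real (s + d) = Complex x y2 + d"
      unfolding pe qe by simp_all
    show "(complex_of_real 1 * p - complex_of_real (s + b)) / (complex_of_real (s + d) - complex_of_real 1 * p) =
    (complex_of_real 1 * q + complex_of_real (s + b)) / (complex_of_real 1 * q + complex_of_real (s + d))"
      unfolding 1 2 using key nd1 nd2 by (simp add: frac_eq_eq)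
  qed
qed

text \<open>
Up to the factor \<open>pi\<close>, \<open>|pi - Arg p - Arg q|\<close> is the difference of the harmonic measures of the positive half
line as seen from \<open>q\<close> and from \<open>- cnj p\<close>. With \<open>p\<close> and \<open>q\<close> in polar coordinates the claim is the inequality
\<open>(1 + A) / 2 * |p + q|\<^sup>2 \<le> |cnj p + q|\<^sup>2\<close> for \<open>A = cos (Arg p + Arg q)\<close>, and the difference of its two sides
splits into two visibly nonnegative terms.
\<close>

lemma arg_sum_le_arcsin_refl_mod:
  assumes p: "Im p > 0" and q: "Im q > 0"
  shows "\<bar>pi - Arg p - Arg q\<bar> / 2 \<le> arcsin (refl_mod p q)"
proof -
  define r s \<alpha> \<beta> where "r = cmod p" and "s = cmod q" and "\<alpha> = Arg p" and "\<beta> = Arg q"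
  have pnz: "p \<noteq> 0" "q \<noteq> 0" using p q by auto
  have rs: "r > 0" "s > 0" using pnz by (auto simp: r_def s_def)
  have pr: "p = r * cis \<alpha>" and qr: "q = s * cis \<beta>"
    using pnz by (auto simp: r_def s_def \<alpha>_def \<beta>_def simp flip: rcis_def intro!: rcis_cmod_Arg[symmetric])
  have ab: "0 < \<alpha>" "\<alpha> < pi" "0 < \<beta>" "\<beta> < pi"
    using p q Arg_lt_pi by (auto simp: \<alpha>_def \<beta>_def)
  have sq1: "(cmod (cnj p + q))\<^sup>2 = r\<^sup>2 + s\<^sup>2 + 2 * r * s * cos (\<alpha> + \<beta>)"
    and sq2: "(cmod (p + q))\<^sup>2 = r\<^sup>2 + s\<^sup>2 + 2 * r * s * cos (\<alpha> - \<beta>)"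
  proof -
    have c: "(cos \<alpha>)\<^sup>2 = 1 - (sin \<alpha>)\<^sup>2" "(cos \<beta>)\<^sup>2 = 1 - (sin \<beta>)\<^sup>2"
      by (simp_all add: cos_squared_eq)
    have "(cmod (cnj p + q))\<^sup>2 = r\<^sup>2 * ((cos \<alpha>)\<^sup>2 + (sin \<alpha>)\<^sup>2) + s\<^sup>2 * ((cos \<beta>)\<^sup>2 + (sin \<beta>)\<^sup>2) + 2 * r * s * cos (\<alpha> + \<beta>)"
      unfolding cmod_power2 pr qr
      by (simp add: cos_add power2_eq_square algebra_simps
          del: sin_cos_squared_add sin_cos_squared_add2 sin_cos_squared_add3)
    then show "(cmod (cnj p + q))\<^sup>2 = r\<^sup>2 + s\<^sup>2 + 2 * r * s * cos (\<alpha> + \<beta>)" by simp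
    have "(cmod (p + q))\<^sup>2 = r\<^sup>2 * ((cos \<alpha>)\<^sup>2 + (sin \<alpha>)\<^sup>2) + s\<^sup>2 * ((cos \<beta>)\<^sup>2 + (sin \<beta>)\<^sup>2) + 2 * r * s * cos (\<alpha> - \<beta>)"
      unfolding cmod_power2 pr qr
      by (simp add: cos_diff power2_eq_square algebra_simps
          del: sin_cos_squared_add sin_cos_squared_add2 sin_cos_squared_add3)
    then show "(cmod (p + q))\<^sup>2 = r\<^sup>2 + s\<^sup>2 + 2 * r * s * cos (\<alpha> - \<beta>)" by simp
  qed
  define A B where "A = cos (\<alpha> + \<beta>)" and "B = cos (\<alpha> - \<beta>)"
  have AB: "-1 \<le> A" "A \<le> 1" "B \<le> 1" by (auto simp: A_def B_def)
  have X: "0 \<le> r\<^sup>2 + s\<^sup>2 - 2 * r * s"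
    using zero_le_power2[of "r - s"] by (simp add: power2_eq_square algebra_simps)
  have "0 \<le> (r\<^sup>2 + s\<^sup>2 - 2 * r * s) * (1 - A) + 2 * (r * s) * ((1 + A) * (1 - B))"
  proof -
    have "0 \<le> 1 + A" "0 \<le> 1 - A" "0 \<le> 1 - B" "0 \<le> r * s" using AB rs by auto
    then have "0 \<le> (1 + A) * (1 - B)" "0 \<le> (r\<^sup>2 + s\<^sup>2 - 2 * r * s) * (1 - A)"
      by (auto intro: mult_nonneg_nonneg[OF X] mult_nonneg_nonneg)
    then have "0 \<le> r * s * ((1 + A) * (1 - B))"
      using \<open>0 \<le> r * s\<close> mult_nonneg_nonneg by blast
    then show ?thesis using \<open>0 \<le> (r\<^sup>2 + s\<^sup>2 - 2 * r * s) * (1 - A)\<close> by linarith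
  qed
  also have "\<dots> = 2 * (cmod (cnj p + q))\<^sup>2 - (1 + A) * (cmod (p + q))\<^sup>2"
    unfolding sq1 sq2 A_def[symmetric] B_def[symmetric] by (simp add: algebra_simps)
  finally have main: "(1 + A) / 2 * (cmod (p + q))\<^sup>2 \<le> (cmod (cnj p + q))\<^sup>2" by simp
  define \<tau> where "\<tau> = (pi - \<alpha> - \<beta>) / 2"
  have "(sin \<tau>)\<^sup>2 = (1 + A) / 2"
  proof -
    have "2 * \<tau> = pi - (\<alpha> + \<beta>)" by (simp add: \<tau>_def)
    then have "cos (2 * \<tau>) = - A" by (simp add: A_def)
    then show ?thesis using cos_double_sin[of \<tau>] by simp
  qed
  have pq: "p + q \<noteq> 0" using p q by (auto simp: complex_eq_iff)
  have "(sin \<bar>\<tau>\<bar>)\<^sup>2 = (1 + A) / 2" using \<open>(sin \<tau>)\<^sup>2 = _\<close> by (simp add: abs_if)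
  also have "\<dots> \<le> (refl_mod p q)\<^sup>2"
    using main pq by (simp add: refl_mod_def power_divide field_simps)
  finally have "sin \<bar>\<tau>\<bar> \<le> refl_mod p q"
    using power2_le_imp_le refl_mod_nonneg by blast
  moreover have "\<bar>\<tau>\<bar> \<le> pi / 2" using ab by (auto simp: \<tau>_def)
  moreover have "refl_mod p q \<le> 1" using refl_mod_le_1 pq p q by auto
  ultimately have "\<bar>\<tau>\<bar> \<le> arcsin (refl_mod p q)"
    by (smt (verit) arcsin_le_arcsin arcsin_sin sin_ge_minus_one)
  then show ?thesis by (simp add: \<tau>_def \<alpha>_def \<beta>_def)
qed

lemma arcsin_refl_mod_diag:
  assumes p: "Im p > 0"
  shows "arcsin (refl_mod p p) = \<bar>pi - Arg p - Arg p\<bar> / 2"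
proof -
  have pnz: "p \<noteq> 0" using p by auto
  have "cnj p + p = of_real (2 * Re p)" by (simp add: complex_eq_iff)
  then have "cmod (cnj p + p) = 2 * \<bar>Re p\<bar>" by (metis abs_mult abs_numeral norm_of_real)
  moreover have "cmod (p + p) = 2 * cmod p" by (metis mult_2 norm_mult norm_numeral)
  ultimately have "refl_mod p p = \<bar>cos (Arg p)\<bar>"
    using pnz by (simp add: refl_mod_def cos_Arg)
  also have "\<dots> = sin (\<bar>pi - Arg p - Arg p\<bar> / 2)"
  proof -
    have "sin (pi / 2 - Arg p) = cos (Arg p)" by (simp add: cos_sin_eq)
    moreover have ap: "0 < Arg p" "Arg p < pi" using p Arg_lt_pi by auto
    ultimately show ?thesis
    proof (cases "Arg p \<le> pi / 2")
      case True
      then have "cos (Arg p) \<ge> 0" using ap by (intro cos_ge_zero) auto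
      then show ?thesis using True \<open>sin _ = _\<close> by (simp add: field_simps)
    next
      case False
      then have "cos (Arg p) \<le> 0" using ap cos_ge_zero[of "pi - Arg p"] by simp
      moreover have "\<bar>pi - Arg p - Arg p\<bar> / 2 = - (pi / 2 - Arg p)" using False by (simp add: field_simps)
      ultimately show ?thesis using \<open>sin _ = _\<close> by (metis abs_of_nonpos sin_minus)
    qed
  qed
  finally have eq: "refl_mod p p = sin (\<bar>pi - Arg p - Arg p\<bar> / 2)" .
  have "\<bar>pi - Arg p - Arg p\<bar> \<le> pi"
    using Arg_lt_pi[of p] p by linarith
  then show ?thesis unfolding eq by (intro arcsin_sin) auto
qed

section \<open>Harmonic minorants\<close>

lemma upper_half_plane_iff [simp]: "z \<in> upper_half_plane \<longleftrightarrow> Im z > 0"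
  by (simp add: upper_half_plane_def)

lemma Herglotz_holomorphic: "Herglotz F \<Longrightarrow> F holomorphic_on upper_half_plane"
  by (simp add: Herglotz_def)

lemma Herglotz_Im_pos: "Herglotz F \<Longrightarrow> Im z > 0 \<Longrightarrow> Im (F z) > 0"
  by (auto simp: Herglotz_def image_subset_iff)

lemma HerglotzI:
  "F holomorphic_on upper_half_plane \<Longrightarrow> (\<And>z. Im z > 0 \<Longrightarrow> Im (F z) > 0) \<Longrightarrow> Herglotz F"
  by (auto simp: Herglotz_def)

lemma Herglotz_moebius:
  fixes a b c d :: real and F :: "complex \<Rightarrow> complex"
  assumes F: "Herglotz F" and det: "a * d - b * c > 0"
  shows "Herglotz (\<lambda>z. (a * F z + b) / (c * F z + d))"
proof (rule HerglotzI)
  have cd: "c \<noteq> 0 \<or> d \<noteq> 0" using det by auto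
  have nz: "c * F z + d \<noteq> 0" if "Im z > 0" for z
    using moebius_denom_nz[OF Herglotz_Im_pos[OF F that] cd] .
  show "(\<lambda>z. (a * F z + b) / (c * F z + d)) holomorphic_on upper_half_plane"
    using nz by (intro holomorphic_intros Herglotz_holomorphic F) auto
  show "Im ((a * F z + b) / (c * F z + d)) > 0" if "Im z > 0" for z
    unfolding Im_moebius[OF nz[OF that]] using det Herglotz_Im_pos[OF F that] nz[OF that]
    by simp
qed

text \<open>
The total variation distance between the harmonic measures of \<open>q z\<close> and \<open>- cnj (p z)\<close>. Unlike the
reflection modulus itself, it is always subharmonic.
\<close>

definition refl_angle :: "(complex \<Rightarrow> complex) \<Rightarrow> (complex \<Rightarrow> complex) \<Rightarrow> complex \<Rightarrow> real" where
  "refl_angle p q z = 2 / pi * arcsin (refl_mod (p z) (q z))"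

text \<open>
Subharmonicity in the form used here: at every point, \<open>u\<close> has a harmonic minorant on the whole half plane
that agrees with it there. The minorants are real parts of holomorphic functions, so that Cauchy's formula
gives their mean values.
\<close>

definition harmonically_supported :: "(complex \<Rightarrow> real) \<Rightarrow> bool" where
  "harmonically_supported u \<longleftrightarrow>
     continuous_on upper_half_plane u \<and> (\<forall>z\<in>upper_half_plane. 0 \<le> u z \<and> u z \<le> 1) \<and>
     (\<forall>z0\<in>upper_half_plane. \<exists>g. g holomorphic_on upper_half_plane \<and>
        (\<forall>z\<in>upper_half_plane. Re (g z) \<le> u z) \<and> Re (g z0) = u z0)"

lemma continuous_on_refl_mod:
  assumes "continuous_on S f" "continuous_on S g" "\<And>x. x \<in> S \<Longrightarrow> f x + g x \<noteq> 0"
  shows "continuous_on S (\<lambda>x. refl_mod (f x) (g x))"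
  unfolding refl_mod_def using assms by (intro continuous_intros) auto

text \<open>
To support the function at \<open>z0\<close>, an isometry that gives \<open>p z0\<close> and \<open>q z0\<close> the same image is fixed. The
arguments of the transformed Herglotz functions are imaginary parts of holomorphic logarithms, and the
inequality between arguments and the reflection modulus is an equality at \<open>z0\<close>.
\<close>

lemma harmonically_supported_refl_angle:
  assumes p: "Herglotz p" and q: "Herglotz q"
  shows "harmonically_supported (refl_angle p q)"
  unfolding harmonically_supported_def
proof (intro conjI ballI)
  have nz: "p z + q z \<noteq> 0" if "Im z > 0" for z
    using Herglotz_Im_pos[OF p that] Herglotz_Im_pos[OF q that] by (auto simp: complex_eq_iff)
  have le1: "refl_mod (p z) (q z) \<le> 1" if "Im z > 0" for z
    using refl_mod_le_1[OF nz[OF that]] Herglotz_Im_pos[OF p that] Herglotz_Im_pos[OF q that] by simp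
  have ge: "-1 \<le> refl_mod (p z) (q z)" for z
    using refl_mod_nonneg[of "p z" "q z"] by linarith
  show "continuous_on upper_half_plane (refl_angle p q)"
    unfolding refl_angle_def using nz le1 ge
    by (intro continuous_intros continuous_on_refl_mod holomorphic_on_imp_continuous_on
        Herglotz_holomorphic p q ballI) auto
  show "0 \<le> refl_angle p q z" if "z \<in> upper_half_plane" for z
    using that arcsin_le_arcsin[of 0 "refl_mod (p z) (q z)"] le1[of z] refl_mod_nonneg
    by (simp add: refl_angle_def)
  show "refl_angle p q z \<le> 1" if "z \<in> upper_half_plane" for z
    using that arcsin_ubound[OF ge le1] by (simp add: refl_angle_def field_simps)
  fix z0 assume "z0 \<in> upper_half_plane"
  then have z0: "Im z0 > 0" by simp
  obtain a b c d :: real where det: "a * d - b * c > 0"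
    and eq: "(a * p z0 - b) / (d - c * p z0) = (a * q z0 + b) / (c * q z0 + d)"
    using moebius_normalise[OF Herglotz_Im_pos[OF p z0] Herglotz_Im_pos[OF q z0]] by blast
  define P Q where "P = (\<lambda>z. (a * p z + of_real (-b)) / (of_real (-c) * p z + d))"
    and "Q = (\<lambda>z. (a * q z + b) / (c * q z + d))"
  have HP: "Herglotz P" unfolding P_def using det by (intro Herglotz_moebius[OF p]) simp
  have HQ: "Herglotz Q" unfolding Q_def using det by (intro Herglotz_moebius[OF q])
  have PQ0: "Q z0 = P z0" using eq by (simp add: P_def Q_def)
  have inv: "refl_mod (P z) (Q z) = refl_mod (p z) (q z)" if "Im z > 0" for z
    using refl_mod_moebius[OF det Herglotz_Im_pos[OF p that] Herglotz_Im_pos[OF q that]]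
    by (simp add: P_def Q_def)
  define g where "g = (\<lambda>z. (pi + \<i> * (Ln (P z) + Ln (Q z))) / pi)"
  have nn: "F z \<notin> \<real>\<^sub>\<le>\<^sub>0" if "Herglotz F" "Im z > 0" for F z
    using Herglotz_Im_pos[OF that] by (auto simp: complex_nonpos_Reals_iff)
  have hol: "g holomorphic_on upper_half_plane"
    unfolding g_def using nn[OF HP] nn[OF HQ]
    by (intro holomorphic_intros Herglotz_holomorphic HP HQ) auto
  have Re_g: "Re (g z) = (pi - Arg (P z) - Arg (Q z)) / pi" if "Im z > 0" for z
    using nn[OF HP that] nn[OF HQ that] by (auto simp: g_def Arg_def Re_divide_of_real)
  have bound: "\<bar>Re (g z)\<bar> \<le> refl_angle p q z" if "Im z > 0" for z
    using arg_sum_le_arcsin_refl_mod[OF Herglotz_Im_pos[OF HP that] Herglotz_Im_pos[OF HQ that]]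
    by (simp add: Re_g[OF that] inv[OF that] refl_angle_def abs_divide field_simps)
  have attained: "\<bar>Re (g z0)\<bar> = refl_angle p q z0"
    using arcsin_refl_mod_diag[OF Herglotz_Im_pos[OF HP z0]] inv[OF z0]
    by (simp add: Re_g[OF z0] refl_angle_def abs_divide PQ0)
  \<comment> \<open>The sign corresponds to the choice between a half line and its complement.\<close>
  define s :: real where "s = (if Re (g z0) \<ge> 0 then 1 else -1)"
  show "\<exists>g. g holomorphic_on upper_half_plane \<and>
        (\<forall>z\<in>upper_half_plane. Re (g z) \<le> refl_angle p q z) \<and> Re (g z0) = refl_angle p q z0"
  proof (intro exI[of _ "\<lambda>z. s * g z"] conjI ballI)
    show "(\<lambda>z. s * g z) holomorphic_on upper_half_plane"
      by (intro holomorphic_intros hol)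
    show "Re (s * g z) \<le> refl_angle p q z" if "z \<in> upper_half_plane" for z
      using bound[of z] that by (auto simp: s_def)
    show "Re (s * g z0) = refl_angle p q z0"
      using attained by (auto simp: s_def)
  qed
qed

section \<open>Means over circles\<close>

text \<open>
Lebesgue measure on an open interval. The endpoints are left out since on \<open>seg 0 1\<close>, which parametrises the
unit circle, they correspond to the point \<open>1\<close> where boundary functions may be singular.
\<close>

abbreviation seg :: "real \<Rightarrow> real \<Rightarrow> real measure" where
  "seg a b \<equiv> restrict_space lborel {a<..<b}"

lemma space_seg [simp]: "space (seg a b) = {a<..<b}"
  by (simp add: space_restrict_space)

lemma emeasure_seg_space: "a \<le> b \<Longrightarrow> emeasure (seg a b) (space (seg a b)) = ennreal (b - a)"
  by (simp add: emeasure_restrict_space)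

lemma finite_measure_seg: "finite_measure (seg a b)"
proof (rule finite_measureI)
  show "emeasure (seg a b) (space (seg a b)) \<noteq> \<infinity>"
    by (cases "a \<le> b") (auto simp: emeasure_seg_space emeasure_restrict_space)
qed

lemma measure_seg_space: "a \<le> b \<Longrightarrow> measure (seg a b) {a<..<b} = b - a"
  using emeasure_seg_space[of a b] by (simp add: measure_def)

lemma integral_seg_const: "a \<le> b \<Longrightarrow> (\<integral>x. c \<partial>seg a b) = (b - a) * (c::real)"
  using measure_seg_space[of a b] by simp

lemma borel_measurable_seg:
  "f \<in> borel_measurable borel \<Longrightarrow> f \<in> borel_measurable (seg a b)"
  by (simp add: measurable_restrict_space1)

lemma borel_measurable_seg_continuous:
  fixes f :: "real \<Rightarrow> 'a::{second_countable_topology,banach}"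
  assumes "continuous_on {a<..<b} f"
  shows "f \<in> borel_measurable (seg a b)"
  using borel_measurable_continuous_on_restrict[OF assms]
  by (simp add: borel_measurable_restrict_space_iff)

lemma integrable_seg_bounded:
  fixes f :: "real \<Rightarrow> 'a::{second_countable_topology,banach}"
  assumes "f \<in> borel_measurable (seg a b)" "\<And>x. a < x \<Longrightarrow> x < b \<Longrightarrow> norm (f x) \<le> B"
  shows "integrable (seg a b) f"
  using assms by (intro finite_measure.integrable_const_bound[OF finite_measure_seg, where B=B]) auto

lemma AE_seg: "AE x in lborel. P x \<Longrightarrow> AE x in seg a b. P x"
  by (subst AE_restrict_space_iff) auto

lemma integral_seg_HK:
  fixes f :: "real \<Rightarrow> 'a::euclidean_space"
  assumes "integrable (seg a b) f"
  shows "f integrable_on {a..b}" "integral\<^sup>L (seg a b) f = integral {a..b} f"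
proof -
  have i: "set_integrable lborel {a<..<b} f"
    using assms by (simp add: integrable_restrict_space set_integrable_def)
  have "(f has_integral integral {a<..<b} f) {a<..<b}"
    using set_borel_integral_eq_integral(1)[OF i] by (simp add: has_integral_integral)
  then have h: "(f has_integral integral {a<..<b} f) {a..b}" by (simp add: has_integral_Icc_iff_Ioo)
  then show "f integrable_on {a..b}" by (rule has_integral_integrable)
  have "integral\<^sup>L (seg a b) f = integral {a<..<b} f"
    using set_borel_integral_eq_integral(2)[OF i]
    by (simp add: integral_restrict_space set_lebesgue_integral_def)
  then show "integral\<^sup>L (seg a b) f = integral {a..b} f"
    using h by (simp add: integral_unique)
qed

lemma integral_seg_eqI:
  fixes f :: "real \<Rightarrow> 'a::euclidean_space"
  assumes c: "continuous_on {a..b} f" and i: "(f has_integral v) {a..b}"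
  shows "integrable (seg a b) f" "integral\<^sup>L (seg a b) f = v"
proof -
  have "bounded (f ` {a..b})"
    by (rule compact_imp_bounded[OF compact_continuous_image[OF c compact_Icc]])
  then obtain B where B: "\<forall>x\<in>{a..b}. norm (f x) \<le> B"
    unfolding bounded_iff by auto
  show I: "integrable (seg a b) f"
    using B by (intro integrable_seg_bounded[of _ _ _ B] borel_measurable_seg_continuous
        continuous_on_subset[OF c]) auto
  show "integral\<^sup>L (seg a b) f = v"
    using integral_seg_HK(2)[OF I] i by (simp add: integral_unique)
qed

lemma circle_mean:
  assumes h: "h holomorphic_on ball 0 1" and r: "0 < r" "r < 1"
  shows "integrable (seg 0 1) (\<lambda>t. h (of_real r * cis (2 * pi * t)))" (is ?A)
    and "(\<integral>t. h (of_real r * cis (2 * pi * t)) \<partial>seg 0 1) = h 0" (is ?B)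
    and "(\<integral>t. h (of_real r * cis (2 * pi * t)) * cis (- (2 * pi * t)) \<partial>seg 0 1) = of_real r * deriv h 0" (is ?C)
proof -
  have cancel: "(f has_integral v) S"
    if "((\<lambda>t. f t * \<kappa>) has_integral v * \<kappa>) S" "\<kappa> \<noteq> 0" for f :: "real \<Rightarrow> complex" and \<kappa> v S
    using has_integral_mult_left[OF that(1), of "inverse \<kappa>"] that(2) by (simp add: mult.assoc)
  have sub: "cball 0 r \<subseteq> ball (0::complex) 1" using r by auto
  have hol: "h holomorphic_on cball 0 r" using h sub by (rule holomorphic_on_subset)
  have cont: "continuous_on (cball 0 r) h" using hol by (rule holomorphic_on_imp_continuous_on)
  have cp: "circlepath 0 r t = of_real r * cis (2 * pi * t)" for t
    by (simp add: circlepath cis_conv_exp mult_ac)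
  have vd: "vector_derivative (circlepath 0 r) (at t within {0..1}) = 2 * pi * \<i> * of_real r * cis (2 * pi * t)"
    if "t \<in> {0..1}" for t
    using that by (simp add: vector_derivative_circlepath01 cis_conv_exp mult_ac)
  have hc: "continuous_on {0..1} (\<lambda>t. h (of_real r * cis (2 * pi * t)))"
    by (rule continuous_on_compose2[OF cont])
      (use r in \<open>auto intro!: continuous_intros simp: norm_mult\<close>)
  have "((\<lambda>u. h u / (u - 0)) has_contour_integral (2 * of_real pi * \<i> * h 0)) (circlepath 0 r)"
    using r by (intro Cauchy_integral_circlepath_simple[OF hol]) auto
  then have "((\<lambda>t. h (of_real r * cis (2 * pi * t)) / (of_real r * cis (2 * pi * t)) *
      (2 * pi * \<i> * of_real r * cis (2 * pi * t))) has_integral 2 * of_real pi * \<i> * h 0) {0..1}"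
    unfolding has_contour_integral_def
    by (rule has_integral_eq[rotated]) (simp add: vd cp)
  then have "((\<lambda>t. h (of_real r * cis (2 * pi * t)) * (2 * pi * \<i>)) has_integral h 0 * (2 * pi * \<i>)) {0..1}"
    by (rule has_integral_eq_rhs[OF has_integral_eq[rotated]]) (use r in \<open>auto\<close>)
  then have hi: "((\<lambda>t. h (of_real r * cis (2 * pi * t))) has_integral h 0) {0..1}"
    by (rule cancel) simp
  show ?A by (rule integral_seg_eqI(1)[OF hc hi])
  show ?B by (rule integral_seg_eqI(2)[OF hc hi])
  have "((\<lambda>u. h u / (u - 0)\<^sup>2) has_contour_integral (2 * pi * \<i> * deriv h 0)) (circlepath 0 r)"
    using Cauchy_has_contour_integral_higher_derivative_circlepath[OF cont
        holomorphic_on_subset[OF hol ball_subset_cball], of 0 1] r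
    by (simp add: power2_eq_square)
  then have "((\<lambda>t. h (of_real r * cis (2 * pi * t)) / (of_real r * cis (2 * pi * t) - 0)\<^sup>2 *
      (2 * pi * \<i> * of_real r * cis (2 * pi * t))) has_integral 2 * pi * \<i> * deriv h 0) {0..1}"
    unfolding has_contour_integral_def
    by (rule has_integral_eq[rotated]) (simp add: vd cp)
  then have "((\<lambda>t. h (of_real r * cis (2 * pi * t)) * cis (- (2 * pi * t)) * (2 * pi * \<i> / r))
      has_integral 2 * pi * \<i> * deriv h 0) {0..1}"
  proof (rule has_integral_eq[rotated])
    fix t
    show "h (of_real r * cis (2 * pi * t)) / (of_real r * cis (2 * pi * t) - 0)\<^sup>2 *
      (2 * pi * \<i> * of_real r * cis (2 * pi * t)) =
      h (of_real r * cis (2 * pi * t)) * cis (- (2 * pi * t)) * (2 * pi * \<i> / r)"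
      using r by (simp add: power2_eq_square field_simps flip: cis_inverse)
  qed
  then have "((\<lambda>t. h (of_real r * cis (2 * pi * t)) * cis (- (2 * pi * t)) * (2 * pi * \<i> / r))
      has_integral (of_real r * deriv h 0) * (2 * pi * \<i> / r)) {0..1}"
    by (rule has_integral_eq_rhs) (use r in simp)
  then have hi2: "((\<lambda>t. h (of_real r * cis (2 * pi * t)) * cis (- (2 * pi * t))) has_integral of_real r * deriv h 0) {0..1}"
    by (rule cancel) (use r in simp)
  show ?C by (rule integral_seg_eqI(2)[OF _ hi2]) (intro continuous_intros hc)
qed

lemma cis_punctured_disc:
  assumes "t \<in> {0<..<1}"
  shows "cis (2 * pi * t) \<in> cball 0 1 - {1}"
proof -
  have "cis (2 * pi * t) \<noteq> 1"
  proof
    assume "cis (2 * pi * t) = 1"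
    then have "cos (2 * pi * t) = 1" by (simp add: complex_eq_iff)
    then obtain n :: int where "2 * pi * t = of_int n * 2 * pi" by (auto simp: cos_one_2pi_int)
    then have "t = of_int n" by simp
    then have "0 < n" "n < 1" using assms by auto
    then show False by linarith
  qed
  then show ?thesis by simp
qed

lemma integrable_unit_circle:
  fixes u :: "complex \<Rightarrow> real"
  assumes u: "continuous_on (cball 0 1 - {1}) u" and B: "\<And>w. w \<in> cball 0 1 - {1} \<Longrightarrow> \<bar>u w\<bar> \<le> B"
  shows "integrable (seg 0 1) (\<lambda>t. u (cis (2 * pi * t)))"
proof (rule integrable_seg_bounded[where B=B])
  show "(\<lambda>t. u (cis (2 * pi * t))) \<in> borel_measurable (seg 0 1)"
    by (intro borel_measurable_seg_continuous continuous_on_compose2[OF u] continuous_intros)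
      (use cis_punctured_disc in auto)
  show "norm (u (cis (2 * pi * t))) \<le> B" if "0 < t" "t < 1" for t
    using B[OF cis_punctured_disc] that by simp
qed

text \<open>
The boundary point \<open>1\<close> may be excluded because \<open>u\<close> is bounded and a single point of the circle is a null
set; below, \<open>1\<close> is the preimage of infinity under the map onto the half plane.
\<close>

lemma circle_limit:
  fixes u :: "complex \<Rightarrow> real"
  assumes u: "continuous_on (cball 0 1 - {1}) u" and B: "\<And>w. w \<in> cball 0 1 - {1} \<Longrightarrow> \<bar>u w\<bar> \<le> B"
    and r: "\<And>k. 0 < r k" "\<And>k. r k < 1" "r \<longlonglongrightarrow> 1"
  shows "(\<lambda>k::nat. \<integral>t. u (of_real (r k) * cis (2 * pi * t)) \<partial>seg 0 1) \<longlonglongrightarrow> (\<integral>t. u (cis (2 * pi * t)) \<partial>seg 0 1)"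
proof (rule integral_dominated_convergence[where w = "\<lambda>_. B"])
  have in2: "of_real (r k) * cis (2 * pi * t) \<in> cball 0 1 - {1}" for k t
  proof -
    have "cmod (of_real (r k) * cis (2 * pi * t)) < 1" using r(1,2)[of k] by (simp add: norm_mult)
    then show ?thesis by auto
  qed
  show "(\<lambda>t. u (cis (2 * pi * t))) \<in> borel_measurable (seg 0 1)"
    using integrable_unit_circle[OF u B] by (rule borel_measurable_integrable)
  show "(\<lambda>t. u (of_real (r k) * cis (2 * pi * t))) \<in> borel_measurable (seg 0 1)" for k
    by (intro borel_measurable_seg_continuous continuous_on_compose2[OF u] continuous_intros)
      (use in2 in auto)
  show "integrable (seg 0 1) (\<lambda>_. B)" by (intro integrable_seg_bounded[of _ _ _ "\<bar>B\<bar>"]) auto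
  show "AE t in seg 0 1. (\<lambda>k. u (of_real (r k) * cis (2 * pi * t))) \<longlonglongrightarrow> u (cis (2 * pi * t))"
  proof (rule AE_I2)
    fix t assume t: "t \<in> space (seg 0 1)"
    have "(\<lambda>k. of_real (r k) * cis (2 * pi * t)) \<longlonglongrightarrow> of_real 1 * cis (2 * pi * t)"
      by (intro tendsto_intros r)
    then show "(\<lambda>k. u (of_real (r k) * cis (2 * pi * t))) \<longlonglongrightarrow> u (cis (2 * pi * t))"
      using t cis_punctured_disc[of t] in2
      by (intro continuous_on_tendsto_compose[OF u]) (auto simp del: mem_cball)
  qed
  show "AE t in seg 0 1. norm (u (of_real (r k) * cis (2 * pi * t))) \<le> B" for k
    using B in2 by (intro AE_I2) auto
qed

lemma subharmonic_circle_bound: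
  fixes u :: "complex \<Rightarrow> real"
  assumes u: "continuous_on (cball 0 1 - {1}) u" and B: "\<And>w. w \<in> cball 0 1 - {1} \<Longrightarrow> \<bar>u w\<bar> \<le> B"
    and g: "g holomorphic_on ball 0 1" "\<And>w. w \<in> ball 0 1 \<Longrightarrow> Re (g w) \<le> u w"
  shows "Re (g 0) \<le> (\<integral>t. u (cis (2 * pi * t)) \<partial>seg 0 1)"
proof -
  define r :: "nat \<Rightarrow> real" where "r k = 1 - 1 / (real k + 2)" for k
  have r: "0 < r k" "r k < 1" for k by (auto simp: r_def field_simps)
  have rl: "r \<longlonglongrightarrow> 1" unfolding r_def by real_asymp
  have ball: "of_real (r k) * cis (2 * pi * t) \<in> ball 0 1" for k t
    using r[of k] by (simp add: norm_mult)
  have "Re (g 0) \<le> (\<integral>t. u (of_real (r k) * cis (2 * pi * t)) \<partial>seg 0 1)" for k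
  proof -
    have "Re (g 0) = (\<integral>t. Re (g (of_real (r k) * cis (2 * pi * t))) \<partial>seg 0 1)"
      using circle_mean(1,2)[OF g(1) r] by (metis integral_Re)
    also have "\<dots> \<le> (\<integral>t. u (of_real (r k) * cis (2 * pi * t)) \<partial>seg 0 1)"
    proof (rule integral_mono)
      show "integrable (seg 0 1) (\<lambda>t. Re (g (of_real (r k) * cis (2 * pi * t))))"
        using circle_mean(1)[OF g(1) r] by (rule integrable_Re)
      show "integrable (seg 0 1) (\<lambda>t. u (of_real (r k) * cis (2 * pi * t)))"
      proof (rule integrable_seg_bounded[where B=B])
        have *: "of_real (r k) * cis (2 * pi * t) \<in> cball 0 1 - {1}" for t
          using ball[of k t] by (auto simp: dist_norm)
        show "(\<lambda>t. u (of_real (r k) * cis (2 * pi * t))) \<in> borel_measurable (seg 0 1)"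
          by (intro borel_measurable_seg_continuous continuous_on_compose2[OF u] continuous_intros)
            (use * in auto)
        show "norm (u (of_real (r k) * cis (2 * pi * t))) \<le> B" for t using B[OF *] by simp
      qed
    qed (use g(2) ball in blast)
    finally show ?thesis .
  qed
  then show ?thesis
    using circle_limit[OF u B r rl] by (intro LIMSEQ_le_const[of _ _ "Re (g 0)"]) auto
qed

lemma holomorphic_circle_bounds:
  assumes h: "h holomorphic_on ball 0 1" and c: "continuous_on (cball 0 1 - {1}) h"
    and B: "\<And>w. w \<in> cball 0 1 - {1} \<Longrightarrow> cmod (h w) \<le> B"
  shows "cmod (h 0) \<le> (\<integral>t. cmod (h (cis (2 * pi * t))) \<partial>seg 0 1)"
    and "cmod (deriv h 0) \<le> (\<integral>t. cmod (h (cis (2 * pi * t))) \<partial>seg 0 1)"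
proof -
  define r :: "nat \<Rightarrow> real" where "r k = 1 - 1 / (real k + 2)" for k
  have r: "0 < r k" "r k < 1" for k by (auto simp: r_def field_simps)
  have rl: "r \<longlonglongrightarrow> 1" unfolding r_def by real_asymp
  have L: "(\<lambda>k. \<integral>t. cmod (h (of_real (r k) * cis (2 * pi * t))) \<partial>seg 0 1)
      \<longlonglongrightarrow> (\<integral>t. cmod (h (cis (2 * pi * t))) \<partial>seg 0 1)"
    by (rule circle_limit[OF _ _ r rl, of _ B]) (use B in \<open>auto intro!: continuous_intros c\<close>)
  have "cmod (h 0) \<le> (\<integral>t. cmod (h (of_real (r k) * cis (2 * pi * t))) \<partial>seg 0 1)" for k
    using circle_mean(2)[OF h r, of k] integral_norm_bound by metis
  then show "cmod (h 0) \<le> (\<integral>t. cmod (h (cis (2 * pi * t))) \<partial>seg 0 1)"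
    using L by (intro LIMSEQ_le_const[of _ _ "cmod (h 0)"]) auto
  have "r k * cmod (deriv h 0) \<le> (\<integral>t. cmod (h (of_real (r k) * cis (2 * pi * t))) \<partial>seg 0 1)" for k
  proof -
    have "r k * cmod (deriv h 0) = cmod (\<integral>t. h (of_real (r k) * cis (2 * pi * t)) * cis (- (2 * pi * t)) \<partial>seg 0 1)"
      unfolding circle_mean(3)[OF h r, of k] using r[of k] by (simp add: norm_mult)
    also have "\<dots> \<le> (\<integral>t. cmod (h (of_real (r k) * cis (2 * pi * t)) * cis (- (2 * pi * t))) \<partial>seg 0 1)"
      by (rule integral_norm_bound)
    finally show ?thesis by (simp add: norm_mult)
  qed
  moreover have "(\<lambda>k. r k * cmod (deriv h 0)) \<longlonglongrightarrow> 1 * cmod (deriv h 0)"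
    by (intro tendsto_intros rl)
  ultimately show "cmod (deriv h 0) \<le> (\<integral>t. cmod (h (cis (2 * pi * t))) \<partial>seg 0 1)"
    using LIMSEQ_le[OF _ L] by auto
qed

section \<open>Means over the boundary of the half plane\<close>

text \<open>
The conformal map of the unit disc onto the upper half plane with \<open>0 \<mapsto> x + i y\<close> and \<open>1 \<mapsto> \<infinity>\<close>. On the unit
circle it turns the uniform distribution into the Poisson kernel of \<open>x + i y\<close>.
\<close>

definition disc_to_half_plane :: "real \<Rightarrow> real \<Rightarrow> complex \<Rightarrow> complex" where
  "disc_to_half_plane x y w = of_real x + \<i> * of_real y * ((1 + w) / (1 - w))"

lemma disc_to_half_plane_0: "disc_to_half_plane x y 0 = Complex x y"
  by (simp add: disc_to_half_plane_def complex_eq_iff)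

lemma Im_disc_to_half_plane:
  "Im (disc_to_half_plane x y w) = y * (1 - (cmod w)\<^sup>2) / (cmod (1 - w))\<^sup>2"
proof -
  have "Re ((1 + w) / (1 - w)) = (1 - (cmod w)\<^sup>2) / (cmod (1 - w))\<^sup>2"
    unfolding Re_divide cmod_power2 by (simp add: power2_eq_square algebra_simps)
  then have "Im (disc_to_half_plane x y w) = y * ((1 - (cmod w)\<^sup>2) / (cmod (1 - w))\<^sup>2)"
    by (simp add: disc_to_half_plane_def del: times_divide_eq_right)
  then show ?thesis by simp
qed

lemma Im_disc_to_half_plane_pos: "0 < y \<Longrightarrow> cmod w < 1 \<Longrightarrow> 0 < Im (disc_to_half_plane x y w)"
  unfolding Im_disc_to_half_plane
  by (intro divide_pos_pos mult_pos_pos) (auto simp: abs_square_less_1)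

lemma Im_disc_to_half_plane_nonneg: "0 < y \<Longrightarrow> cmod w \<le> 1 \<Longrightarrow> 0 \<le> Im (disc_to_half_plane x y w)"
  unfolding Im_disc_to_half_plane
  by (intro divide_nonneg_nonneg mult_nonneg_nonneg) (auto simp: power_le_one)

lemma disc_to_half_plane_cis:
  assumes "0 < t" "t < 1"
  shows "disc_to_half_plane x y (cis (2 * pi * t)) = Complex (x - y * cot (pi * t)) 0"
proof -
  define s where "s = pi * t"
  have s: "sin s > 0" using assms unfolding s_def by (intro sin_gt_zero) auto
  have c2: "cis (2 * pi * t) = (cis s)\<^sup>2" by (simp add: s_def cis_mult power2_eq_square mult.assoc)
  have i: "1 = cis s * cis (- s)" by (simp add: cis_mult)
  have 1: "1 + (cis s)\<^sup>2 = cis s * (2 * cos s)" and 2: "1 - (cis s)\<^sup>2 = cis s * (- 2 * \<i> * sin s)"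
    by (subst i, simp add: complex_eq_iff power2_eq_square algebra_simps)+
  have "(1 + (cis s)\<^sup>2) / (1 - (cis s)\<^sup>2) = \<i> * cot s"
    unfolding 1 2 using s by (simp add: cot_def field_simps)
  then show ?thesis
    by (simp add: disc_to_half_plane_def c2 s_def complex_eq_iff del: times_divide_eq_right)
qed

lemma disc_to_half_plane_holomorphic: "disc_to_half_plane x y holomorphic_on - {1}"
  unfolding disc_to_half_plane_def by (intro holomorphic_intros) auto

text \<open>
The Poisson integral bound, with the Poisson kernel expressed as the distribution of \<open>x - y * cot (pi * t)\<close> for
\<open>t\<close> uniform in \<open>(0, 1)\<close>.
\<close>

lemma subharmonic_half_plane_bound:
  fixes u :: "complex \<Rightarrow> real"
  assumes u: "continuous_on {z. Im z \<ge> 0} u" and B: "\<And>z. Im z \<ge> 0 \<Longrightarrow> \<bar>u z\<bar> \<le> B"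
    and g: "g holomorphic_on upper_half_plane" "\<And>z. Im z > 0 \<Longrightarrow> Re (g z) \<le> u z"
    and y: "y > 0"
  shows "Re (g (Complex x y)) \<le> (\<integral>t. u (Complex (x - y * cot (pi * t)) 0) \<partial>seg 0 1)"
proof -
  let ?d = "disc_to_half_plane x y"
  have "Re ((g \<circ> ?d) 0) \<le> (\<integral>t. (u \<circ> ?d) (cis (2 * pi * t)) \<partial>seg 0 1)"
  proof (rule subharmonic_circle_bound[of _ B])
    show "continuous_on (cball 0 1 - {1}) (u \<circ> ?d)"
      using Im_disc_to_half_plane_nonneg[OF y]
      by (intro continuous_on_compose holomorphic_on_imp_continuous_on
          holomorphic_on_subset[OF disc_to_half_plane_holomorphic] continuous_on_subset[OF u]) auto
    show "\<bar>(u \<circ> ?d) w\<bar> \<le> B" if "w \<in> cball 0 1 - {1}" for w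
      using that Im_disc_to_half_plane_nonneg[OF y] B by auto
    show "g \<circ> ?d holomorphic_on ball 0 1"
      using Im_disc_to_half_plane_pos[OF y]
      by (intro holomorphic_on_compose_gen[OF holomorphic_on_subset[OF disc_to_half_plane_holomorphic] g(1)]) auto
    show "Re ((g \<circ> ?d) w) \<le> (u \<circ> ?d) w" if "w \<in> ball 0 1" for w
      using that Im_disc_to_half_plane_pos[OF y] g(2) by auto
  qed
  also have "\<dots> = (\<integral>t. u (Complex (x - y * cot (pi * t)) 0) \<partial>seg 0 1)"
    by (intro Bochner_Integration.integral_cong) (auto simp: disc_to_half_plane_cis)
  finally show ?thesis by (simp add: disc_to_half_plane_0)
qed

text \<open>
A bound for how far Poisson averaging at height \<open>y\<close> can raise the integral of a function with values in
\<open>[0, 1]\<close> over an interval of length \<open>L\<close>: a shift by \<open>s\<close> raises it by at most \<open>2 |s|\<close> and by at most \<open>L\<close>, and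
\<open>s = y * cot (pi * t)\<close> is averaged over \<open>t\<close>.
\<close>

definition shift_error :: "real \<Rightarrow> real \<Rightarrow> real" where
  "shift_error L y = (\<integral>t. min (2 * y * \<bar>cot (pi * t)\<bar>) L \<partial>seg 0 1)"

lemma borel_measurable_cot_seg [measurable]:
  "(\<lambda>t. cot (pi * t)) \<in> borel_measurable (seg a b)"
  by (rule borel_measurable_seg) (unfold cot_def, measurable)

lemma integrable_shift_error:
  assumes "0 \<le> L" "0 \<le> y"
  shows "integrable (seg 0 1) (\<lambda>t. min (2 * y * \<bar>cot (pi * t)\<bar>) L)"
  by (rule integrable_seg_bounded[where B=L]) (use assms in \<open>auto simp: abs_le_iff min_def\<close>)

lemma shift_error_tendsto_0:
  assumes L: "0 \<le> L" and Y: "\<And>k. 0 \<le> Y k" "Y \<longlonglongrightarrow> 0"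
  shows "(\<lambda>k. shift_error L (Y k)) \<longlonglongrightarrow> 0"
proof -
  have "(\<lambda>k. \<integral>t. min (2 * Y k * \<bar>cot (pi * t)\<bar>) L \<partial>seg 0 1) \<longlonglongrightarrow> (\<integral>t. 0 \<partial>seg 0 1)"
  proof (rule integral_dominated_convergence[where w = "\<lambda>_. L"])
    show "integrable (seg 0 1) (\<lambda>_. L)" by (intro integrable_seg_bounded[of _ _ _ "\<bar>L\<bar>"]) auto
    show "AE t in seg 0 1. (\<lambda>k. min (2 * Y k * \<bar>cot (pi * t)\<bar>) L) \<longlonglongrightarrow> 0"
    proof (rule AE_I2)
      fix t
      have "(\<lambda>k. min (2 * Y k * \<bar>cot (pi * t)\<bar>) L) \<longlonglongrightarrow> min (2 * 0 * \<bar>cot (pi * t)\<bar>) L"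
        by (intro tendsto_intros Y)
      then show "(\<lambda>k. min (2 * Y k * \<bar>cot (pi * t)\<bar>) L) \<longlonglongrightarrow> 0" using L by simp
    qed
    show "AE t in seg 0 1. norm (min (2 * Y k * \<bar>cot (pi * t)\<bar>) L) \<le> L" for k
      using L Y(1)[of k] by (intro AE_I2) (auto simp: abs_le_iff min_def)
  qed auto
  then show ?thesis by (simp add: shift_error_def)
qed

text \<open>
A shift exchanges the contributions of two pieces of length \<open>|s|\<close> at the ends of the interval.
\<close>

lemma integral_shift_le:
  fixes v :: "real \<Rightarrow> real"
  assumes v: "v \<in> borel_measurable borel" and B: "\<And>x. 0 \<le> v x" "\<And>x. v x \<le> 1" and ab: "a \<le> b"
  shows "(\<integral>x. v (x - s) \<partial>seg a b) \<le> (\<integral>x. v x \<partial>seg a b) + min (2 * \<bar>s\<bar>) (b - a)"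
proof -
  note v [measurable]
  have int: "integrable lborel (\<lambda>x. indicator {c<..<d} x * v x)" for c d
  proof -
    have "integrable (seg c d) v"
      by (rule integrable_seg_bounded[where B=1]) (use v B in \<open>auto intro: borel_measurable_seg\<close>)
    then show ?thesis by (simp add: integrable_restrict_space)
  qed
  have int1: "integrable lborel (indicator {c<..<d} :: real \<Rightarrow> real)" for c d
    by (cases "c \<le> d") (auto simp: integrable_indicator_iff)
  have e: "(\<integral>x. v x \<partial>seg c d) = (\<integral>x. indicator {c<..<d} x * v x \<partial>lborel)" for c d
    by (simp add: integral_restrict_space)
  have "(\<integral>x. v (x - s) \<partial>seg a b) = (\<integral>x. indicator {a<..<b} x * v (x - s) \<partial>lborel)"
    by (simp add: integral_restrict_space)
  also have "\<dots> = (\<integral>x. indicator {a<..<b} (x + s) * v x \<partial>lborel)"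
    using lborel_integral_real_affine[of 1 "\<lambda>x. indicator {a<..<b} x * v (x - s)" s]
    by (simp add: add.commute)
  also have "\<dots> = (\<integral>x. indicator {a - s<..<b - s} x * v x \<partial>lborel)"
    by (intro Bochner_Integration.integral_cong) (auto simp: indicator_def)
  finally have E: "(\<integral>x. v (x - s) \<partial>seg a b) = (\<integral>x. indicator {a - s<..<b - s} x * v x \<partial>lborel)" .
  have pos: "0 \<le> (\<integral>x. v x \<partial>seg a b)" using B by simp
  have "(\<integral>x. indicator {a - s<..<b - s} x * v x \<partial>lborel) \<le> (\<integral>x. indicator {a - s<..<b - s} x \<partial>lborel)"
    using B by (intro integral_mono int int1) (auto simp: indicator_def)
  also have "\<dots> = b - a" using ab by simp
  finally have 1: "(\<integral>x. v (x - s) \<partial>seg a b) \<le> b - a" using E by simp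
  have "(\<integral>x. indicator {a - s<..<b - s} x * v x \<partial>lborel)
      \<le> (\<integral>x. indicator {a<..<b} x * v x + (indicator {a - \<bar>s\<bar>..a} x + indicator {b..b + \<bar>s\<bar>} x) \<partial>lborel)"
  proof (rule integral_mono)
    show "integrable lborel (\<lambda>x. indicator {a<..<b} x * v x + (indicator {a - \<bar>s\<bar>..a} x + indicator {b..b + \<bar>s\<bar>} x))"
      by (intro Bochner_Integration.integrable_add int) (auto simp: integrable_indicator_iff)
    show "integrable lborel (\<lambda>x. indicator {a - s<..<b - s} x * v x)" by (rule int)
  qed (use B in \<open>auto simp: indicator_def\<close>)
  also have "\<dots> = (\<integral>x. indicator {a<..<b} x * v x \<partial>lborel) + (\<bar>s\<bar> + \<bar>s\<bar>)"
    by (subst Bochner_Integration.integral_add) (auto intro: int)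
  finally have "(\<integral>x. v (x - s) \<partial>seg a b) \<le> (\<integral>x. v x \<partial>seg a b) + 2 * \<bar>s\<bar>"
    unfolding E e by simp
  with 1 pos show ?thesis by (simp add: min_def)
qed

lemma continuous_on_Complex_line:
  assumes "continuous_on upper_half_plane (u :: complex \<Rightarrow> 'a::topological_space)" "c > 0"
  shows "continuous_on UNIV (\<lambda>x. u (Complex x c))"
  unfolding Complex_eq
  by (rule continuous_on_compose2[OF assms(1)]) (use assms(2) in \<open>auto intro!: continuous_intros\<close>)

text \<open>
Integrating the Poisson bound over an interval and exchanging the integrals turns the average over the
kernel into an average over shifts of the interval. The resulting error does not depend on \<open>u\<close> or \<open>\<delta>\<close>, so
that limits in both can be taken afterwards. The shift by \<open>\<delta>\<close> makes \<open>u\<close> continuous up to the boundary.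
\<close>

lemma interval_estimate_interior:
  assumes u: "harmonically_supported u" and y: "y > 0" and \<delta>: "\<delta> > 0" and ab: "a \<le> b"
  shows "(\<integral>x. u (Complex x (y + \<delta>)) \<partial>seg a b) \<le> (\<integral>x. u (Complex x \<delta>) \<partial>seg a b) + shift_error (b - a) y"
proof -
  have cu: "continuous_on upper_half_plane u"
    and u01: "\<And>z. Im z > 0 \<Longrightarrow> 0 \<le> u z" "\<And>z. Im z > 0 \<Longrightarrow> u z \<le> 1"
    using u by (auto simp: harmonically_supported_def)
  define v where "v = (\<lambda>x. u (Complex x \<delta>))"
  have cv: "continuous_on UNIV v" unfolding v_def by (rule continuous_on_Complex_line[OF cu \<delta>])
  then have v [measurable]: "v \<in> borel_measurable borel"
    by (rule borel_measurable_continuous_onI)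
  have v01: "0 \<le> v x" "v x \<le> 1" for x using u01 \<delta> by (auto simp: v_def)
  have pw: "u (Complex x (y + \<delta>)) \<le> (\<integral>t. v (x - y * cot (pi * t)) \<partial>seg 0 1)" for x
  proof -
    have "Complex x (y + \<delta>) \<in> upper_half_plane" using y \<delta> by simp
    then obtain g where g: "g holomorphic_on upper_half_plane" "\<And>z. Im z > 0 \<Longrightarrow> Re (g z) \<le> u z"
      "Re (g (Complex x (y + \<delta>))) = u (Complex x (y + \<delta>))"
      using u unfolding harmonically_supported_def by (metis upper_half_plane_iff)
    have "Re ((\<lambda>z. g (z + \<i> * \<delta>)) (Complex x y))
        \<le> (\<integral>t. (\<lambda>z. u (z + \<i> * \<delta>)) (Complex (x - y * cot (pi * t)) 0) \<partial>seg 0 1)"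
    proof (rule subharmonic_half_plane_bound[where B=1])
      show "continuous_on {z. 0 \<le> Im z} (\<lambda>z. u (z + \<i> * \<delta>))"
        by (rule continuous_on_compose2[OF cu]) (use \<delta> in \<open>auto intro!: continuous_intros\<close>)
      show "\<bar>u (z + \<i> * \<delta>)\<bar> \<le> 1" if "0 \<le> Im z" for z
        using u01[of "z + \<i> * \<delta>"] that \<delta> by auto
      show "(\<lambda>z. g (z + \<i> * \<delta>)) holomorphic_on upper_half_plane"
        by (rule holomorphic_on_compose_gen[OF _ g(1), of "\<lambda>z. z + \<i> * \<delta>", unfolded o_def])
          (use \<delta> in \<open>auto intro!: holomorphic_intros\<close>)
    qed (use g \<delta> y in auto)
    moreover have "Complex s c + \<i> * \<delta> = Complex s (c + \<delta>)" for s c by (simp add: complex_eq_iff)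
    ultimately show ?thesis using g(3) by (simp add: v_def)
  qed
  interpret X: finite_measure "seg a b" by (rule finite_measure_seg)
  interpret T: finite_measure "seg 0 1" by (rule finite_measure_seg)
  interpret P: pair_sigma_finite "seg a b" "seg 0 1" ..
  have M: "(\<lambda>(x, t). v (x - y * cot (pi * t))) \<in> borel_measurable (seg a b \<Otimes>\<^sub>M seg 0 1)"
  proof -
    have [measurable]: "(\<lambda>p. fst p) \<in> borel_measurable (seg a b \<Otimes>\<^sub>M seg 0 1)"
      by (rule measurable_compose[OF measurable_fst borel_measurable_seg]) simp
    have [measurable]: "(\<lambda>p. cot (pi * snd p)) \<in> borel_measurable (seg a b \<Otimes>\<^sub>M seg 0 1)"
      by (rule measurable_compose[OF measurable_snd borel_measurable_cot_seg])
    show ?thesis unfolding case_prod_beta by measurable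
  qed
  have PI: "integrable (seg a b \<Otimes>\<^sub>M seg 0 1) (\<lambda>(x, t). v (x - y * cot (pi * t)))"
  proof -
    interpret PP: finite_measure "seg a b \<Otimes>\<^sub>M seg 0 1"
      by (intro finite_measure_pair_measure finite_measure_seg)
    show ?thesis by (rule PP.integrable_const_bound[OF _ M, of 1]) (auto simp: v01)
  qed
  have "(\<integral>x. u (Complex x (y + \<delta>)) \<partial>seg a b) \<le> (\<integral>x. (\<integral>t. v (x - y * cot (pi * t)) \<partial>seg 0 1) \<partial>seg a b)"
  proof (rule integral_mono)
    have "u (Complex x (y + \<delta>)) \<le> 1" "0 \<le> u (Complex x (y + \<delta>))" for x using u01 y \<delta> by auto
    then show "integrable (seg a b) (\<lambda>x. u (Complex x (y + \<delta>)))"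
      by (intro integrable_seg_bounded[where B=1] borel_measurable_seg borel_measurable_continuous_onI
        continuous_on_Complex_line[OF cu]) (use y \<delta> in auto)
    show "integrable (seg a b) (\<lambda>x. \<integral>t. v (x - y * cot (pi * t)) \<partial>seg 0 1)"
      using P.integrable_fst'[OF PI] by simp
  qed (rule pw)
  also have "\<dots> = (\<integral>t. (\<integral>x. v (x - y * cot (pi * t)) \<partial>seg a b) \<partial>seg 0 1)"
    using P.Fubini_integral[OF PI] by simp
  also have "\<dots> \<le> (\<integral>t. ((\<integral>x. v x \<partial>seg a b) + min (2 * y * \<bar>cot (pi * t)\<bar>) (b - a)) \<partial>seg 0 1)"
  proof (rule integral_mono)
    show "integrable (seg 0 1) (\<lambda>t. \<integral>x. v (x - y * cot (pi * t)) \<partial>seg a b)"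
      using P.integrable_snd[OF PI] by simp
    show "integrable (seg 0 1) (\<lambda>t. (\<integral>x. v x \<partial>seg a b) + min (2 * y * \<bar>cot (pi * t)\<bar>) (b - a))"
      using ab y by (intro Bochner_Integration.integrable_add integrable_shift_error T.integrable_const) auto
    show "(\<integral>x. v (x - y * cot (pi * t)) \<partial>seg a b) \<le> (\<integral>x. v x \<partial>seg a b) + min (2 * y * \<bar>cot (pi * t)\<bar>) (b - a)" for t
      using integral_shift_le[OF v v01 ab, of "y * cot (pi * t)"] y by (simp add: abs_mult)
  qed
  also have "\<dots> = (\<integral>x. v x \<partial>seg a b) + shift_error (b - a) y"
    using ab y by (subst Bochner_Integration.integral_add)
      (use integral_seg_const[of 0 1] in
        \<open>simp_all add: shift_error_def integrable_shift_error T.integrable_const del: lebesgue_integral_const\<close>)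
  finally show ?thesis by (simp add: v_def)
qed

section \<open>Vertical traces and their comparison\<close>

text \<open>
Boundary values along the fixed heights \<open>1 / (k + 1)\<close>, which makes them Borel measurable without any
exceptional set. Clipping to \<open>[0, 1]\<close> keeps them bounded where the limit fails to exist.
\<close>

definition vertical_trace :: "(complex \<Rightarrow> real) \<Rightarrow> real \<Rightarrow> real" where
  "vertical_trace u x = max 0 (min 1 (lim (\<lambda>k. u (Complex x (1 / real (Suc k))))))"

definition has_vertical_trace :: "(complex \<Rightarrow> real) \<Rightarrow> bool" where
  "has_vertical_trace u \<longleftrightarrow> (AE x in lborel. convergent (\<lambda>k. u (Complex x (1 / real (Suc k)))))"

lemma vertical_trace_bounds: "0 \<le> vertical_trace u x" "vertical_trace u x \<le> 1"
  by (auto simp: vertical_trace_def)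

lemma borel_measurable_line:
  assumes "harmonically_supported u" "c > 0"
  shows "(\<lambda>x. u (Complex x c)) \<in> borel_measurable borel"
  using assms by (intro borel_measurable_continuous_onI continuous_on_Complex_line)
    (auto simp: harmonically_supported_def)

lemma borel_measurable_vertical_trace:
  assumes "harmonically_supported u"
  shows "vertical_trace u \<in> borel_measurable borel"
proof -
  have [measurable]: "(\<lambda>x. u (Complex x (1 / real (Suc k)))) \<in> borel_measurable borel" for k
    by (rule borel_measurable_line[OF assms]) simp
  show ?thesis unfolding vertical_trace_def by measurable
qed

lemma integrable_vertical_trace:
  assumes "harmonically_supported u"
  shows "integrable (seg a b) (vertical_trace u)"
  using vertical_trace_bounds[of u]
  by (intro integrable_seg_bounded[where B=1] borel_measurable_seg borel_measurable_vertical_trace[OF assms]) auto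

lemma vertical_trace_eqI:
  assumes "(\<lambda>k. u (Complex x (1 / real (Suc k)))) \<longlonglongrightarrow> l" "0 \<le> l" "l \<le> 1"
  shows "vertical_trace u x = l"
  using assms(2,3) limI[OF assms(1)] by (simp add: vertical_trace_def)

lemma integral_tendsto_vertical_trace:
  assumes u: "harmonically_supported u" and t: "has_vertical_trace u"
  shows "(\<lambda>k. \<integral>x. u (Complex x (1 / real (Suc k))) \<partial>seg a b) \<longlonglongrightarrow> (\<integral>x. vertical_trace u x \<partial>seg a b)"
proof (rule integral_dominated_convergence[where w = "\<lambda>_. 1"])
  have u01: "0 \<le> u (Complex x (1 / real (Suc k)))" "u (Complex x (1 / real (Suc k))) \<le> 1" for x k
    using u by (auto simp: harmonically_supported_def)
  show "vertical_trace u \<in> borel_measurable (seg a b)"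
    by (intro borel_measurable_seg borel_measurable_vertical_trace[OF u])
  show "(\<lambda>x. u (Complex x (1 / real (Suc k)))) \<in> borel_measurable (seg a b)" for k
    by (intro borel_measurable_seg borel_measurable_line[OF u]) simp
  show "integrable (seg a b) (\<lambda>_. 1::real)" by (intro integrable_seg_bounded[where B=1]) auto
  show "AE x in seg a b. norm (u (Complex x (1 / real (Suc k)))) \<le> 1" for k
    using u01 by (intro AE_I2) auto
  show "AE x in seg a b. (\<lambda>k. u (Complex x (1 / real (Suc k)))) \<longlonglongrightarrow> vertical_trace u x"
    using AE_seg[OF t[unfolded has_vertical_trace_def]]
  proof eventually_elim
    case (elim x)
    then obtain l where l: "(\<lambda>k. u (Complex x (1 / real (Suc k)))) \<longlonglongrightarrow> l"
      by (auto simp: convergent_def)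
    have "0 \<le> l" "l \<le> 1"
      using u01 LIMSEQ_le_const[OF l, of 0] LIMSEQ_le_const2[OF l, of 1] by auto
    then show ?case using vertical_trace_eqI[OF l] l by simp
  qed
qed

lemma interval_estimate:
  assumes u: "harmonically_supported u" and t: "has_vertical_trace u" and y: "y > 0" and ab: "a \<le> b"
  shows "(\<integral>x. u (Complex x y) \<partial>seg a b) \<le> (\<integral>x. vertical_trace u x \<partial>seg a b) + shift_error (b - a) y"
proof (rule LIMSEQ_le)
  have cu: "continuous_on upper_half_plane u"
    and u01: "\<And>z. Im z > 0 \<Longrightarrow> 0 \<le> u z" "\<And>z. Im z > 0 \<Longrightarrow> u z \<le> 1"
    using u by (auto simp: harmonically_supported_def)
  show "(\<lambda>k. (\<integral>x. u (Complex x (1 / real (Suc k))) \<partial>seg a b) + shift_error (b - a) y)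
      \<longlonglongrightarrow> (\<integral>x. vertical_trace u x \<partial>seg a b) + shift_error (b - a) y"
    by (intro tendsto_intros integral_tendsto_vertical_trace u t)
  have p: "y + 1 / real (Suc k) > 0" for k using y by (simp add: add_pos_pos)
  show "(\<lambda>k. \<integral>x. u (Complex x (y + 1 / real (Suc k))) \<partial>seg a b) \<longlonglongrightarrow> (\<integral>x. u (Complex x y) \<partial>seg a b)"
  proof (rule integral_dominated_convergence[where w = "\<lambda>_. 1"])
    show "(\<lambda>x. u (Complex x y)) \<in> borel_measurable (seg a b)"
      by (intro borel_measurable_seg borel_measurable_line[OF u] y)
    show "(\<lambda>x. u (Complex x (y + 1 / real (Suc k)))) \<in> borel_measurable (seg a b)" for k
      by (intro borel_measurable_seg borel_measurable_line[OF u] p)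
    show "integrable (seg a b) (\<lambda>_. 1::real)" by (intro integrable_seg_bounded[where B=1]) auto
    show "AE x in seg a b. norm (u (Complex x (y + 1 / real (Suc k)))) \<le> 1" for k
      using u01 p by (intro AE_I2) auto
    show "AE x in seg a b. (\<lambda>k. u (Complex x (y + 1 / real (Suc k)))) \<longlonglongrightarrow> u (Complex x y)"
    proof (rule AE_I2)
      fix x
      have "(\<lambda>k. y + 1 / real (Suc k)) \<longlonglongrightarrow> y + 0" by (intro tendsto_intros LIMSEQ_Suc lim_inverse_n'[unfolded inverse_eq_divide])
      then have "(\<lambda>k. Complex x (y + 1 / real (Suc k))) \<longlonglongrightarrow> Complex x y"
        by (intro tendsto_Complex) auto
      then show "(\<lambda>k. u (Complex x (y + 1 / real (Suc k)))) \<longlonglongrightarrow> u (Complex x y)"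
        using y p by (intro continuous_on_tendsto_compose[OF cu]) auto
    qed
  qed
  show "\<exists>N. \<forall>k\<ge>N. (\<integral>x. u (Complex x (y + 1 / real (Suc k))) \<partial>seg a b)
      \<le> (\<integral>x. u (Complex x (1 / real (Suc k))) \<partial>seg a b) + shift_error (b - a) y"
    using interval_estimate_interior[OF u y _ ab] by auto
qed

text \<open>
Almost everywhere a locally integrable function is the limit of its averages over shrinking intervals.
\<close>

lemma AE_le_if_interval_integrals_le:
  fixes f g :: "real \<Rightarrow> real"
  assumes f: "\<And>a b. integrable (seg a b) f" and g: "\<And>a b. integrable (seg a b) g"
    and le: "\<And>a b. a \<le> b \<Longrightarrow> (\<integral>x. f x \<partial>seg a b) \<le> (\<integral>x. g x \<partial>seg a b)"
  shows "AE x in lebesgue. f x \<le> g x"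
proof -
  define d where "d = (\<lambda>x. f x - g x)"
  have d: "integrable (seg a b) d" for a b unfolding d_def using f g by simp
  have dle: "integral {a..b} d \<le> 0" if "a \<le> b" for a b
    using integral_seg_HK(2)[OF d, of a b] le[OF that] f g by (simp add: d_def)
  have "d integrable_on cbox a b" for a b using integral_seg_HK(1)[OF d] by simp
  then obtain N where N: "negligible N" and av: "\<And>x e. \<lbrakk>x \<notin> N; 0 < e\<rbrakk> \<Longrightarrow>
      \<exists>r>0. \<forall>h. 0 < h \<and> h < r \<longrightarrow>
        norm (integral (cbox x (x + h *\<^sub>R One)) d /\<^sub>R h ^ DIM(real) - d x) < e"
    using integrable_ccontinuous_explicit by blast
  have "d x \<le> 0" if x: "x \<notin> N" for x
  proof (rule ccontr)
    assume "\<not> d x \<le> 0"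
    then have "0 < d x" by simp
    from av[OF x this] obtain r where r: "r > 0" and
      "\<And>h. 0 < h \<Longrightarrow> h < r \<Longrightarrow> norm (integral (cbox x (x + h *\<^sub>R One)) d /\<^sub>R h ^ DIM(real) - d x) < d x"
      by blast
    from this(2)[of "r / 2"] have "\<bar>integral {x..x + r/2} d / (r/2) - d x\<bar> < d x"
      using r by (simp add: field_simps)
    moreover have "integral {x..x + r/2} d / (r/2) \<le> 0"
      using dle[of x "x + r/2"] r by (simp add: divide_le_0_iff)
    ultimately show False by linarith
  qed
  moreover have "AE x in lebesgue. x \<notin> N"
    using N by (simp add: negligible_iff_null_sets AE_not_in)
  ultimately show ?thesis by (auto simp: d_def elim!: eventually_mono)
qed

text \<open>
The comparison principle behind both the main theorem and the finiteness of boundary values. The order of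
the limits matters: at fixed height \<open>y\<close> first \<open>n\<close> tends to infinity, using convergence inside the half plane
only, and then \<open>y\<close> tends to \<open>0\<close>.
\<close>

lemma vertical_trace_le_sup:
  assumes u: "harmonically_supported u" and t: "has_vertical_trace u"
    and un: "\<And>n::nat. harmonically_supported (v n)" and tn: "\<And>n. has_vertical_trace (v n)"
    and conv: "\<And>z. Im z > 0 \<Longrightarrow> (\<lambda>n. v n z) \<longlonglongrightarrow> u z"
  shows "AE x in lebesgue. vertical_trace u x \<le> (SUP n\<in>{N..}. vertical_trace (v n) x)"
proof (rule AE_le_if_interval_integrals_le)
  define S where "S = (\<lambda>x. SUP n\<in>{N..}. vertical_trace (v n) x)"
  have bdd: "bdd_above ((\<lambda>n. vertical_trace (v n) x) ` {N..})" for x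
    by (rule bdd_aboveI2[where M=1]) (rule vertical_trace_bounds)
  have Smeas: "S \<in> borel_measurable borel"
    unfolding S_def by (rule borel_measurable_cSUP) (auto intro: borel_measurable_vertical_trace un bdd)
  have S1: "S x \<le> 1" for x unfolding S_def by (rule cSUP_least) (auto intro: vertical_trace_bounds)
  have Sge: "vertical_trace (v n) x \<le> S x" if "n \<ge> N" for n x
    unfolding S_def using that by (intro cSUP_upper bdd) auto
  have S0: "0 \<le> S x" for x using Sge[of N x] vertical_trace_bounds(1)[of "v N" x] by simp
  have Sint: "integrable (seg a b) S" for a b
    using S0 S1 by (intro integrable_seg_bounded[where B=1] borel_measurable_seg Smeas) auto
  then show "integrable (seg a b) (\<lambda>x. SUP n\<in>{N..}. vertical_trace (v n) x)" for a b by (simp add: S_def)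
  show "integrable (seg a b) (vertical_trace u)" for a b by (rule integrable_vertical_trace[OF u])
  fix a b :: real assume ab: "a \<le> b"
  have step: "(\<integral>x. u (Complex x y) \<partial>seg a b) \<le> (\<integral>x. S x \<partial>seg a b) + shift_error (b - a) y" if y: "y > 0" for y
  proof (rule LIMSEQ_le_const2)
    show "(\<lambda>n. \<integral>x. v n (Complex x y) \<partial>seg a b) \<longlonglongrightarrow> (\<integral>x. u (Complex x y) \<partial>seg a b)"
    proof (rule integral_dominated_convergence[where w = "\<lambda>_. 1"])
      show "(\<lambda>x. u (Complex x y)) \<in> borel_measurable (seg a b)"
        by (intro borel_measurable_seg borel_measurable_line[OF u] y)
      show "(\<lambda>x. v n (Complex x y)) \<in> borel_measurable (seg a b)" for n
        by (intro borel_measurable_seg borel_measurable_line[OF un] y)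
      show "integrable (seg a b) (\<lambda>_. 1::real)" by (intro integrable_seg_bounded[where B=1]) auto
      show "AE x in seg a b. norm (v n (Complex x y)) \<le> 1" for n
        using un[of n] y by (intro AE_I2) (auto simp: harmonically_supported_def)
    qed (use conv y in auto)
    have "(\<integral>x. v n (Complex x y) \<partial>seg a b) \<le> (\<integral>x. S x \<partial>seg a b) + shift_error (b - a) y" if "n \<ge> N" for n
    proof -
      have "(\<integral>x. vertical_trace (v n) x \<partial>seg a b) \<le> (\<integral>x. S x \<partial>seg a b)"
        using Sge[OF that] by (intro integral_mono integrable_vertical_trace un Sint) auto
      then show ?thesis using interval_estimate[OF un tn y ab, of n] by linarith
    qed
    then show "\<exists>M. \<forall>n\<ge>M. (\<integral>x. v n (Complex x y) \<partial>seg a b) \<le> (\<integral>x. S x \<partial>seg a b) + shift_error (b - a) y"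
      by blast
  qed
  have Y: "(\<lambda>k. 1 / real (Suc k)) \<longlonglongrightarrow> 0"
    by (intro LIMSEQ_Suc lim_inverse_n'[unfolded inverse_eq_divide])
  have "(\<lambda>k. (\<integral>x. S x \<partial>seg a b) + shift_error (b - a) (1 / real (Suc k))) \<longlonglongrightarrow> (\<integral>x. S x \<partial>seg a b) + 0"
    using ab by (intro tendsto_intros shift_error_tendsto_0 Y) auto
  then have "(\<integral>x. vertical_trace u x \<partial>seg a b) \<le> (\<integral>x. S x \<partial>seg a b) + 0"
    using step by (intro LIMSEQ_le[OF integral_tendsto_vertical_trace[OF u t]]) auto
  then show "(\<integral>x. vertical_trace u x \<partial>seg a b) \<le> (\<integral>x. (SUP n\<in>{N..}. vertical_trace (v n) x) \<partial>seg a b)"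
    by (simp add: S_def)
qed

section \<open>Vertical limits of Herglotz functions\<close>

text \<open>
Averages over intervals to the right of a point converge almost everywhere to the integrand. Applied to the
integrand and to its reflection, this controls the difference quotients from both sides.
\<close>

lemma DERIV_indefinite_integral_AE:
  fixes F f :: "real \<Rightarrow> real"
  assumes int: "\<And>a b. f integrable_on {a..b}"
    and F: "\<And>a b. a \<le> b \<Longrightarrow> F b - F a = integral {a..b} f"
  shows "AE x in lebesgue. (F has_real_derivative f x) (at x)"
proof -
  have right: "\<exists>N. negligible N \<and> (\<forall>x e. x \<notin> N \<and> 0 < e \<longrightarrow>
      (\<exists>r>0. \<forall>h. 0 < h \<and> h < r \<longrightarrow> \<bar>integral {x..x + h} p / h - p x\<bar> < e))"
    if "\<And>a b. p integrable_on {a..b}" for p :: "real \<Rightarrow> real"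
  proof -
    have pi: "p integrable_on cbox a b" for a b using that by simp
    obtain N where "negligible N" "\<And>x e. \<lbrakk>x \<notin> N; 0 < e\<rbrakk> \<Longrightarrow>
      \<exists>r>0. \<forall>h. 0 < h \<and> h < r \<longrightarrow>
        norm (integral (cbox x (x + h *\<^sub>R One)) p /\<^sub>R h ^ DIM(real) - p x) < e"
      using integrable_ccontinuous_explicit[OF pi] by blast
    then show ?thesis by (intro exI[of _ N]) (simp add: divide_inverse mult.commute)
  qed
  obtain N1 where N1: "negligible N1"
    "\<And>x e. x \<notin> N1 \<Longrightarrow> 0 < e \<Longrightarrow> \<exists>r>0. \<forall>h. 0 < h \<and> h < r \<longrightarrow> \<bar>integral {x..x + h} f / h - f x\<bar> < e"
    using right[OF int] by metis
  have "(\<lambda>x. f (- x)) integrable_on {a..b}" for a b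
    using Henstock_Kurzweil_Integration.integrable_reflect_real[where f=f and a="-b" and b="-a"] int by simp
  from right[OF this] obtain N2 where N2: "negligible N2"
    "\<And>x e. x \<notin> N2 \<Longrightarrow> 0 < e \<Longrightarrow>
        \<exists>r>0. \<forall>h. 0 < h \<and> h < r \<longrightarrow> \<bar>integral {x..x + h} (\<lambda>x. f (- x)) / h - f (- x)\<bar> < e"
    by metis
  define N where "N = N1 \<union> uminus ` N2"
  have "negligible (uminus ` N2)"
    by (intro negligible_differentiable_image_negligible[OF order_refl N2(1)] derivative_intros)
  then have N: "negligible N" using N1 by (simp add: N_def)
  have "(F has_real_derivative f x) (at x)" if "x \<notin> N" for x
    unfolding DERIV_def LIM_eq
  proof (intro allI impI)
    fix e :: real assume e: "0 < e"
    have "x \<notin> N1" "- x \<notin> N2" using that by (auto simp: N_def image_iff)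
    obtain r1 where r1: "r1 > 0" "\<And>h. 0 < h \<Longrightarrow> h < r1 \<Longrightarrow> \<bar>integral {x..x + h} f / h - f x\<bar> < e"
      using N1(2)[OF \<open>x \<notin> N1\<close> e] by blast
    obtain r2 where r2: "r2 > 0" "\<And>h. 0 < h \<Longrightarrow> h < r2 \<Longrightarrow>
        \<bar>integral {- x..- x + h} (\<lambda>x. f (- x)) / h - f x\<bar> < e"
      using N2(2)[OF \<open>- x \<notin> N2\<close> e] by auto
    show "\<exists>s>0. \<forall>h. h \<noteq> 0 \<and> norm (h - 0) < s \<longrightarrow> norm ((F (x + h) - F x) / h - f x) < e"
    proof (intro exI[of _ "min r1 r2"] conjI allI impI)
      show "0 < min r1 r2" using r1 r2 by simp
      fix h :: real assume h: "h \<noteq> 0 \<and> norm (h - 0) < min r1 r2"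
      show "norm ((F (x + h) - F x) / h - f x) < e"
      proof (cases "h > 0")
        case True
        then show ?thesis using r1(2)[of h] h F[of x "x + h"] by simp
      next
        case False
        then have "integral {- x..- x + - h} (\<lambda>x. f (- x)) = F x - F (x + h)"
          using Henstock_Kurzweil_Integration.integral_reflect_real[where a="x + h" and b=x and f=f] F[of "x + h" x] h by simp
        moreover have "(F x - F (x + h)) / - h = (F (x + h) - F x) / h"
          by (metis minus_diff_eq minus_divide_divide)
        ultimately show ?thesis using r2(2)[of "- h"] h False by simp
      qed
    qed
  qed
  then show ?thesis
    using AE_not_in[of N lebesgue] N by (auto simp: negligible_iff_null_sets elim!: eventually_mono)
qed

lemma emeasure_interval_measure_Ioo:
  fixes F :: "real \<Rightarrow> real"
  assumes mono: "\<And>x y. x \<le> y \<Longrightarrow> F x \<le> F y" and cont: "continuous_on UNIV F" and "a \<le> b"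
  shows "emeasure (interval_measure F) {a<..<b} = ennreal (F b - F a)"
proof (cases "a = b")
  case False
  then have "a < b" using assms by simp
  have rc: "continuous (at_right c) F" for c
    using cont by (simp add: continuous_on_eq_continuous_within continuous_within_subset[of c UNIV])
  have "emeasure (interval_measure F) {b..b} = ennreal (F b - F b)"
    by (rule emeasure_interval_measure_Icc[OF order_refl mono cont])
  then have "{b} \<in> null_sets (interval_measure F)" by (intro null_setsI) auto
  moreover have "{a<..<b} = {a<..b} - {b}" using \<open>a < b\<close> by auto
  ultimately have "emeasure (interval_measure F) {a<..<b} = emeasure (interval_measure F) {a<..b}"
    by (simp add: emeasure_Diff_null_set)
  also have "\<dots> = ennreal (F b - F a)"
    by (rule emeasure_interval_measure_Ioc[OF \<open>a \<le> b\<close> mono rc])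
  finally show ?thesis .
qed (use assms in simp)

text \<open>
For \<open>|g x - g y| \<le> |x - y|\<close> the functions \<open>(x + g x) / 2\<close> and \<open>(x - g x) / 2\<close> are increasing and add up to \<open>x\<close>.
Hence their Stieltjes measures add up to Lebesgue measure. In particular the first one is absolutely
continuous, and by the Radon-Nikodym theorem \<open>g\<close> is an indefinite integral up to a linear term.
\<close>

lemma nonexpansive_differentiable_AE:
  fixes g :: "real \<Rightarrow> real"
  assumes lip: "\<And>x y. \<bar>g x - g y\<bar> \<le> \<bar>x - y\<bar>"
  shows "AE x in lebesgue. \<exists>l. (g has_real_derivative l) (at x)"
proof -
  have cg: "continuous_on UNIV g"
  proof (rule continuous_onI)
    fix x e :: real assume "e > 0"
    then show "\<exists>d>0. \<forall>x'\<in>UNIV. dist x' x < d \<longrightarrow> dist (g x') (g x) \<le> e"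
      using le_less_trans[OF lip] by (intro exI[of _ e]) (auto simp: dist_real_def intro: less_imp_le)
  qed
  define F G where "F = (\<lambda>x. (x + g x) / 2)" and "G = (\<lambda>x. (x - g x) / 2)"
  have mono: "F x \<le> F y" "G x \<le> G y" if "x \<le> y" for x y
    using lip[of x y] that by (auto simp: F_def G_def abs_le_iff)
  have cont: "continuous_on UNIV F" "continuous_on UNIV G"
    unfolding F_def G_def by (intro continuous_intros cg; simp)+
  define \<mu> where "\<mu> = measure_of UNIV (sets borel)
      (\<lambda>A. emeasure (interval_measure F) A + emeasure (interval_measure G) A)"
  have sets_mu: "sets \<mu> = sets borel"
    unfolding \<mu>_def using sets.sigma_sets_eq[of "borel :: real measure"] by simp
  have mu: "emeasure \<mu> A = emeasure (interval_measure F) A + emeasure (interval_measure G) A"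
    if A: "A \<in> sets borel" for A
  proof (rule emeasure_measure_of[OF \<mu>_def])
    show "countably_additive (sets \<mu>) (\<lambda>A. emeasure (interval_measure F) A + emeasure (interval_measure G) A)"
      unfolding countably_additive_def
    proof (intro allI impI)
      fix A :: "nat \<Rightarrow> real set" assume A: "range A \<subseteq> sets \<mu>" "disjoint_family A" "\<Union> (range A) \<in> sets \<mu>"
      have "(\<Sum>i. emeasure (interval_measure F) (A i) + emeasure (interval_measure G) (A i))
          = (\<Sum>i. emeasure (interval_measure F) (A i)) + (\<Sum>i. emeasure (interval_measure G) (A i))"
        by (intro suminf_add[symmetric] summableI)
      also have "\<dots> = emeasure (interval_measure F) (\<Union> (range A)) + emeasure (interval_measure G) (\<Union> (range A))"
        using A by (simp add: sets_mu suminf_emeasure)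
      finally show "(\<Sum>i. emeasure (interval_measure F) (A i) + emeasure (interval_measure G) (A i)) =
         emeasure (interval_measure F) (\<Union> (range A)) + emeasure (interval_measure G) (\<Union> (range A))" .
    qed
  qed (use A sets_mu in \<open>auto simp: positive_def\<close>)
  have lb: "lborel = \<mu>"
  proof (rule lborel_eqI)
    fix l u :: real assume "\<And>b. b \<in> Basis \<Longrightarrow> l \<bullet> b \<le> u \<bullet> b"
    then have lu: "l \<le> u" by simp
    have "emeasure \<mu> {l<..<u} = ennreal (F u - F l) + ennreal (G u - G l)"
      by (simp add: mu emeasure_interval_measure_Ioo[OF mono(1) cont(1) lu]
          emeasure_interval_measure_Ioo[OF mono(2) cont(2) lu])
    also have "\<dots> = ennreal (u - l)"
      using mono[OF lu] by (subst ennreal_plus[symmetric]) (auto simp: F_def G_def field_simps)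
    finally show "emeasure \<mu> (box l u) = (\<Prod>b\<in>Basis. (u - l) \<bullet> b)" by (simp add: box_real)
  qed (rule sets_mu)
  have "absolutely_continuous lborel (interval_measure F)"
    unfolding absolutely_continuous_def
  proof
    fix A :: "real set" assume A: "A \<in> null_sets lborel"
    then have "emeasure \<mu> A = 0" "A \<in> sets borel" using lb by auto
    then show "A \<in> null_sets (interval_measure F)" using mu[of A] by (intro null_setsI) auto
  qed
  then obtain f where f: "f \<in> borel_measurable lborel" and dens: "density lborel f = interval_measure F"
    using sigma_finite_measure.Radon_Nikodym[OF sigma_finite_lborel, of "interval_measure F"] by auto
  have nn: "(\<integral>\<^sup>+x. f x \<partial>seg a b) = ennreal (F b - F a)" if "a \<le> b" for a b
  proof -
    have "(\<integral>\<^sup>+x. f x \<partial>seg a b) = (\<integral>\<^sup>+x. f x * indicator {a<..<b} x \<partial>lborel)"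
      by (simp add: nn_integral_restrict_space)
    also have "\<dots> = emeasure (density lborel f) {a<..<b}" by (rule emeasure_density[OF f, symmetric]) simp
    finally show ?thesis
      unfolding dens by (simp add: emeasure_interval_measure_Ioo[OF mono(1) cont(1) that])
  qed
  have bi: "has_bochner_integral (seg a b) (\<lambda>x. enn2real (f x)) (F b - F a)" if ab: "a \<le> b" for a b
  proof (rule has_bochner_integral_nn_integral)
    have fm: "f \<in> borel_measurable (seg a b)" using f by (simp add: borel_measurable_seg)
    then show "(\<lambda>x. enn2real (f x)) \<in> borel_measurable (seg a b)" by measurable
    have "AE x in seg a b. f x \<noteq> \<infinity>"
      by (rule nn_integral_PInf_AE[OF fm]) (simp add: nn[OF ab])
    then have "(\<integral>\<^sup>+x. ennreal (enn2real (f x)) \<partial>seg a b) = (\<integral>\<^sup>+x. f x \<partial>seg a b)"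
      by (intro nn_integral_cong_AE) (auto simp: less_top)
    then show "(\<integral>\<^sup>+x. ennreal (enn2real (f x)) \<partial>seg a b) = ennreal (F b - F a)"
      by (simp add: nn[OF ab])
  qed (use mono[OF ab] in auto)
  have "AE x in lebesgue. (F has_real_derivative enn2real (f x)) (at x)"
  proof (rule DERIV_indefinite_integral_AE)
    show "(\<lambda>x. enn2real (f x)) integrable_on {a..b}" for a b
    proof (cases "a \<le> b")
      case True then show ?thesis using integral_seg_HK(1) bi by (metis has_bochner_integral_iff)
    qed auto
    show "F b - F a = integral {a..b} (\<lambda>x. enn2real (f x))" if "a \<le> b" for a b
      using integral_seg_HK(2) bi[OF that] by (metis has_bochner_integral_iff)
  qed
  then show ?thesis
  proof eventually_elim
    case (elim x)
    have "((\<lambda>x. 2 * F x - x) has_real_derivative 2 * enn2real (f x) - 1) (at x)"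
      using elim by (auto intro!: derivative_eq_intros)
    moreover have "(\<lambda>x. 2 * F x - x) = g" by (rule ext) (simp add: F_def field_simps)
    ultimately show ?case by auto
  qed
qed

text \<open>
Fatou's theorem for the derivative of a Lipschitz function \<open>G\<close>. After subtracting the first order Taylor
polynomial at \<open>x\<close>, the remainder \<open>g\<close> is \<open>o(|s|)\<close> along the real line. Cauchy's formulas for value and
derivative at the centre, applied to \<open>g\<close> pulled back to the disc, bound \<open>G' - f\<close> at \<open>x + i y\<close> by the average
of \<open>|g| / |s|\<close> over the boundary at scale \<open>y\<close>. The factor \<open>(1 - w)\<^sup>2\<close> compensates for the linear growth of \<open>g\<close>
at infinity and gives the integrand the right decay.
\<close>

lemma half_plane_primitive_radial_limit:
  fixes G :: "complex \<Rightarrow> complex"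
  assumes lip: "\<And>z w. Im z \<ge> 0 \<Longrightarrow> Im w \<ge> 0 \<Longrightarrow> cmod (G z - G w) \<le> cmod (z - w)"
    and hol: "G holomorphic_on upper_half_plane"
    and der: "((\<lambda>t. G (of_real t)) has_vector_derivative f) (at x)"
  shows "((\<lambda>y. deriv G (Complex x y)) \<longlongrightarrow> f) (at_right 0)"
proof -
  define g where "g = (\<lambda>z. G z - G (of_real x) - f * (z - of_real x))"
  \<comment> \<open>At \<open>s = 0\<close> the quotient is \<open>0\<close>, which makes \<open>\<psi>\<close> continuous there.\<close>
  define \<psi> where "\<psi> = (\<lambda>s. cmod (g (of_real (x + s))) / \<bar>s\<bar>)"
  define C where "C = 1 + cmod f"
  have g_le: "cmod (g z) \<le> C * cmod (z - of_real x)" if "Im z \<ge> 0" for z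
  proof -
    have "cmod (g z) \<le> cmod (G z - G (of_real x)) + cmod (f * (z - of_real x))"
      unfolding g_def by (rule norm_triangle_ineq4)
    also have "\<dots> \<le> cmod (z - of_real x) + cmod f * cmod (z - of_real x)"
      using lip[of z "of_real x"] that by (simp add: norm_mult)
    finally show ?thesis by (simp add: C_def algebra_simps)
  qed
  have cG: "continuous_on {z. Im z \<ge> 0} G"
  proof (rule continuous_onI)
    fix z e assume "z \<in> {z. Im z \<ge> 0}" "(0::real) < e"
    then show "\<exists>d>0. \<forall>w\<in>{z. Im z \<ge> 0}. dist w z < d \<longrightarrow> dist (G w) (G z) \<le> e"
      using le_less_trans[OF lip] by (intro exI[of _ e]) (auto simp: dist_norm intro: less_imp_le)
  qed
  have cg: "continuous_on {z. Im z \<ge> 0} g" unfolding g_def by (intro continuous_intros cG)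
  have holg: "g holomorphic_on upper_half_plane" unfolding g_def by (intro holomorphic_intros hol)
  have g0: "g (of_real x) = 0" by (simp add: g_def)
  have cgr: "continuous_on UNIV (\<lambda>s. g (of_real (x + s)))"
    by (rule continuous_on_compose2[OF cg]) (auto intro!: continuous_intros)
  have \<psi>_meas: "\<psi> \<in> borel_measurable borel"
    using borel_measurable_continuous_onI[OF cgr] unfolding \<psi>_def by measurable
  have \<psi>_bd: "0 \<le> \<psi> s" "\<psi> s \<le> C" for s
  proof -
    show "0 \<le> \<psi> s" by (simp add: \<psi>_def)
    have "cmod (g (of_real (x + s))) \<le> C * \<bar>s\<bar>" using g_le[of "of_real (x + s)"] by simp
    moreover have "0 \<le> C" by (simp add: C_def)
    ultimately show "\<psi> s \<le> C" by (cases "s = 0") (auto simp: \<psi>_def divide_le_eq)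
  qed
  have \<psi>_lim: "(\<psi> \<longlongrightarrow> 0) (at 0)"
  proof -
    have "((\<lambda>t. g (of_real t)) has_vector_derivative (f - f * 1)) (at x)"
      unfolding g_def
      by (rule derivative_eq_intros der has_vector_derivative_of_real refl | simp)+
    then show ?thesis
      by (simp add: has_vector_derivative_def has_derivative_at \<psi>_def g0)
  qed
  have main: "cmod (deriv G (Complex x y) - f) \<le> 6 * (\<integral>t. \<psi> (- (y * cot (pi * t))) \<partial>seg 0 1)" if y: "y > 0" for y
  proof -
    let ?d = "disc_to_half_plane x y"
    define z0 where "z0 = Complex x y"
    define h where "h = (\<lambda>w. (1 - w)\<^sup>2 * g (?d w))"
    have d0: "?d 0 = z0" by (simp add: z0_def disc_to_half_plane_0)
    have hd: "?d holomorphic_on ball 0 1"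
      by (rule holomorphic_on_subset[OF disc_to_half_plane_holomorphic]) auto
    have hh: "h holomorphic_on ball 0 1"
      unfolding h_def using Im_disc_to_half_plane_pos[OF y]
      by (intro holomorphic_intros holomorphic_on_compose_gen[OF hd holg, unfolded o_def]) auto
    have ch: "continuous_on (cball 0 1 - {1}) h"
      unfolding h_def using Im_disc_to_half_plane_nonneg[OF y]
      by (intro continuous_intros continuous_on_compose2[OF cg] holomorphic_on_imp_continuous_on
          holomorphic_on_subset[OF disc_to_half_plane_holomorphic]) auto
    have bh: "cmod (h w) \<le> C * y * 4" if w: "w \<in> cball 0 1 - {1}" for w
    proof -
      have w1: "cmod w \<le> 1" "w \<noteq> 1" using w by auto
      have "cmod (h w) \<le> (cmod (1 - w))\<^sup>2 * (C * cmod (?d w - of_real x))"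
        unfolding h_def norm_mult norm_power
        using w1 by (intro mult_left_mono g_le Im_disc_to_half_plane_nonneg[OF y]) auto
      also have "\<dots> = C * y * (cmod (1 - w) * cmod (1 + w))"
        using w1 y by (simp add: disc_to_half_plane_def norm_mult norm_divide power2_eq_square)
      also have "\<dots> \<le> C * y * (2 * 2)"
        using y w1 norm_triangle_ineq[of 1 w] norm_triangle_ineq4[of 1 w]
        by (intro mult_left_mono mult_mono) (auto simp: C_def)
      finally show ?thesis by simp
    qed
    have dd: "(?d has_field_derivative (2 * \<i> * y)) (at 0)"
      unfolding disc_to_half_plane_def by (auto intro!: derivative_eq_intros)
    have dG: "(G has_field_derivative deriv G z0) (at z0)"
      using hol y by (intro holomorphic_derivI[of _ upper_half_plane])
        (auto simp: z0_def upper_half_plane_def open_halfspace_Im_gt)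
    have dg: "(g has_field_derivative (deriv G z0 - f)) (at (?d 0))"
      unfolding g_def d0 using dG by (auto intro!: derivative_eq_intros)
    have "(h has_field_derivative (- 2 * g z0 + (deriv G z0 - f) * (2 * \<i> * y))) (at 0)"
      unfolding h_def using DERIV_chain2[OF dg dd] by (auto intro!: derivative_eq_intros simp: d0)
    then have dh: "deriv h 0 = - 2 * g z0 + (deriv G z0 - f) * (2 * \<i> * y)"
      by (rule DERIV_imp_deriv)
    have h0: "h 0 = g z0" by (simp add: h_def d0)
    define J where "J = (\<integral>t. cmod (h (cis (2 * pi * t))) \<partial>seg 0 1)"
    \<comment> \<open>The derivative of \<open>(1 - w)\<^sup>2\<close> at \<open>0\<close> contributes \<open>- 2 * g z0\<close>, which the term \<open>2 * h 0\<close> cancels.\<close>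
    have "2 * y * cmod (deriv G z0 - f) = cmod ((deriv G z0 - f) * (2 * \<i> * y))"
      using y by (simp add: norm_mult)
    also have "\<dots> = cmod (deriv h 0 + 2 * h 0)" by (simp add: dh h0)
    also have "\<dots> \<le> cmod (deriv h 0) + 2 * cmod (h 0)"
      by (metis norm_triangle_ineq norm_mult norm_numeral)
    also have "\<dots> \<le> 3 * J"
      using holomorphic_circle_bounds[OF hh ch bh] by (simp add: J_def)
    also have "J \<le> (\<integral>t. 4 * y * \<psi> (- (y * cot (pi * t))) \<partial>seg 0 1)"
      unfolding J_def
    proof (rule integral_mono)
      show "integrable (seg 0 1) (\<lambda>t. cmod (h (cis (2 * pi * t))))"
        using bh by (intro integrable_unit_circle[of _ "C * y * 4"] continuous_intros ch) auto
      show "integrable (seg 0 1) (\<lambda>t. 4 * y * \<psi> (- (y * cot (pi * t))))"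
        by (intro integrable_mult_right integrable_seg_bounded[where B=C]
            measurable_compose[OF _ \<psi>_meas]) (use \<psi>_bd in auto)
      fix t assume "t \<in> space (seg 0 1)"
      then have t: "0 < t" "t < 1" by auto
      define s where "s = - (y * cot (pi * t))"
      have dt: "?d (cis (2 * pi * t)) = of_real (x + s)"
        unfolding disc_to_half_plane_cis[OF t] by (simp add: s_def complex_eq_iff)
      have sinp: "sin (pi * t) > 0" using t by (intro sin_gt_zero) auto
      have n2: "(cmod (1 - cis (2 * pi * t)))\<^sup>2 = 4 * (sin (pi * t))\<^sup>2"
      proof -
        have "(cmod (1 - cis (2 * pi * t)))\<^sup>2 = 2 - 2 * cos (2 * (pi * t))"
        proof -
          have "(cmod (1 - cis (2 * pi * t)))\<^sup>2 = (1 - cos (2 * (pi * t)))\<^sup>2 + (sin (2 * (pi * t)))\<^sup>2"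
            unfolding cmod_power2 by (simp add: mult.assoc)
          also have "\<dots> = 2 - 2 * cos (2 * (pi * t))"
            using sin_cos_squared_add[of "2 * (pi * t)"] by (simp add: power2_eq_square algebra_simps del: sin_cos_squared_add sin_cos_squared_add2 sin_cos_squared_add3)
          finally show ?thesis .
        qed
        then show ?thesis using cos_double_sin[of "pi * t"] by simp
      qed
      have gs: "cmod (g (of_real (x + s))) = \<bar>s\<bar> * \<psi> s"
        using g0 by (cases "s = 0") (auto simp: \<psi>_def)
      have "cmod (h (cis (2 * pi * t))) = 4 * (sin (pi * t))\<^sup>2 * (\<bar>s\<bar> * \<psi> s)"
        unfolding h_def dt norm_mult norm_power n2 gs ..
      also have "\<dots> = 4 * y * \<psi> s * (sin (pi * t) * \<bar>cos (pi * t)\<bar>)"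
        using sinp y by (simp add: s_def cot_def abs_mult abs_divide power2_eq_square)
      also have "\<dots> \<le> 4 * y * \<psi> s * (1 * 1)"
        using sinp y \<psi>_bd by (intro mult_left_mono mult_mono) auto
      finally show "cmod (h (cis (2 * pi * t))) \<le> 4 * y * \<psi> (- (y * cot (pi * t)))"
        by (simp add: s_def)
    qed
    finally have "2 * y * cmod (deriv G z0 - f) \<le> 2 * y * (6 * (\<integral>t. \<psi> (- (y * cot (pi * t))) \<partial>seg 0 1))"
      by simp
    then show ?thesis using y by (simp add: z0_def)
  qed
  show ?thesis
    unfolding tendsto_at_iff_sequentially o_def
  proof (intro allI impI)
    fix Y :: "nat \<Rightarrow> real" assume "\<forall>k. Y k \<in> {0<..} - {0}" and Y: "Y \<longlonglongrightarrow> 0"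
    then have Yp: "Y k > 0" for k by auto
    have "(\<lambda>k. \<integral>t. \<psi> (- (Y k * cot (pi * t))) \<partial>seg 0 1) \<longlonglongrightarrow> (\<integral>t. 0 \<partial>seg 0 1)"
    proof (rule integral_dominated_convergence[where w = "\<lambda>_. C"])
      show "(\<lambda>t. \<psi> (- (Y k * cot (pi * t)))) \<in> borel_measurable (seg 0 1)" for k
        by (intro measurable_compose[OF _ \<psi>_meas]) simp
      show "integrable (seg 0 1) (\<lambda>_. C)" by (intro integrable_seg_bounded[where B="\<bar>C\<bar>"]) auto
      show "AE t in seg 0 1. norm (\<psi> (- (Y k * cot (pi * t)))) \<le> C" for k
        using \<psi>_bd by (intro AE_I2) auto
      show "AE t in seg 0 1. (\<lambda>k. \<psi> (- (Y k * cot (pi * t)))) \<longlonglongrightarrow> 0"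
      proof (rule AE_I2)
        fix t
        have "isCont \<psi> 0" using \<psi>_lim by (simp add: isCont_def \<psi>_def)
        moreover have "(\<lambda>k. - (Y k * cot (pi * t))) \<longlonglongrightarrow> - (0 * cot (pi * t))"
          by (intro tendsto_intros Y)
        ultimately show "(\<lambda>k. \<psi> (- (Y k * cot (pi * t)))) \<longlonglongrightarrow> 0"
          using isCont_tendsto_compose[of 0 \<psi> "\<lambda>k. - (Y k * cot (pi * t))" sequentially] by (simp add: \<psi>_def)
      qed
    qed auto
    then have "(\<lambda>k. 6 * (\<integral>t. \<psi> (- (Y k * cot (pi * t))) \<partial>seg 0 1)) \<longlonglongrightarrow> 0"
      by (auto intro: tendsto_mult_right_zero)
    then have "(\<lambda>k. deriv G (Complex x (Y k)) - f) \<longlonglongrightarrow> 0"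
      by (rule Lim_null_comparison[rotated]) (use main Yp in auto)
    then show "(\<lambda>k. deriv G (Complex x (Y k))) \<longlonglongrightarrow> f" by (simp add: LIM_zero_iff)
  qed
qed

text \<open>
A primitive of a function bounded by \<open>1\<close> is Lipschitz with constant \<open>1\<close>, so it extends continuously to the
real line and its real and imaginary parts are differentiable almost everywhere there.
\<close>

lemma bounded_holomorphic_boundary_limit_AE:
  assumes hol: "F holomorphic_on upper_half_plane" and bd: "\<And>z. Im z > 0 \<Longrightarrow> cmod (F z) \<le> 1"
  shows "AE x in lebesgue. \<exists>l. ((\<lambda>y. F (Complex x y)) \<longlongrightarrow> l) (at_right 0)"
proof -
  have op: "open upper_half_plane" and cv: "convex upper_half_plane"
    by (simp_all add: upper_half_plane_def open_halfspace_Im_gt convex_halfspace_Im_gt)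
  obtain G0 where G0: "\<And>z. z \<in> upper_half_plane \<Longrightarrow> (G0 has_field_derivative F z) (at z within upper_half_plane)"
    using holomorphic_convex_primitive'[OF cv op hol] by blast
  have "1-lipschitz_on upper_half_plane G0"
  proof (rule lipschitz_onI)
    fix z w assume "z \<in> upper_half_plane" "w \<in> upper_half_plane"
    then show "dist (G0 z) (G0 w) \<le> 1 * dist z w"
      unfolding dist_norm using bd by (intro field_differentiable_bound[OF cv G0]) auto
  qed simp
  then obtain G where G: "1-lipschitz_on (closure upper_half_plane) G" and GG: "\<And>z. z \<in> upper_half_plane \<Longrightarrow> G z = G0 z"
    using lipschitz_extend_closure by blast
  have "closure upper_half_plane = {z. Im z \<ge> 0}"
    using closure_halfspace_gt[of \<i> 0] by (simp add: upper_half_plane_def inner_complex_def)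
  then have lip: "cmod (G z - G w) \<le> cmod (z - w)" if "Im z \<ge> 0" "Im w \<ge> 0" for z w
    using lipschitz_onD[OF G, of z w] that by (simp add: dist_norm)
  have DG: "(G has_field_derivative F z) (at z)" if z: "Im z > 0" for z
  proof -
    have "(G has_field_derivative F z) (at z within upper_half_plane)"
      using z by (intro has_field_derivative_transform_within[OF G0, of z 1]) (auto simp: GG)
    then show ?thesis using z op by (simp add: at_within_open[of _ upper_half_plane])
  qed
  have holG: "G holomorphic_on upper_half_plane"
    using DG op unfolding holomorphic_on_open[OF op] by (meson upper_half_plane_iff)
  have "\<bar>Re (G (of_real s)) - Re (G (of_real t))\<bar> \<le> \<bar>s - t\<bar>"
    "\<bar>Im (G (of_real s)) - Im (G (of_real t))\<bar> \<le> \<bar>s - t\<bar>" for s t :: real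
    using lip[of "of_real s" "of_real t"] abs_Re_le_cmod[of "G (of_real s) - G (of_real t)"]
      abs_Im_le_cmod[of "G (of_real s) - G (of_real t)"] 
    by (simp_all flip: of_real_diff)
  from nonexpansive_differentiable_AE[OF this(1)] nonexpansive_differentiable_AE[OF this(2)]
  show ?thesis
  proof eventually_elim
    case (elim x)
    then obtain a b where ab: "((\<lambda>t. Re (G (of_real t))) has_real_derivative a) (at x)"
      "((\<lambda>t. Im (G (of_real t))) has_real_derivative b) (at x)" by blast
    have "((\<lambda>t. of_real (Re (G (of_real t))) + \<i> * of_real (Im (G (of_real t)))) has_vector_derivative
        of_real a + \<i> * of_real b) (at x)"
      using ab by (intro has_vector_derivative_add has_vector_derivative_mult_right has_vector_derivative_of_real)
        (simp_all add: has_real_derivative_iff_has_vector_derivative)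
    then have "((\<lambda>t. G (of_real t)) has_vector_derivative (of_real a + \<i> * of_real b)) (at x)"
      by (simp flip: complex_eq)
    from half_plane_primitive_radial_limit[OF lip holG this]
    have "((\<lambda>y. deriv G (Complex x y)) \<longlongrightarrow> of_real a + \<i> * of_real b) (at_right 0)" by simp
    moreover have "eventually (\<lambda>y. deriv G (Complex x y) = F (Complex x y)) (at_right 0)"
      using eventually_at_right_less[of 0] by eventually_elim (simp add: DERIV_imp_deriv[OF DG])
    ultimately have "((\<lambda>y. F (Complex x y)) \<longlongrightarrow> of_real a + \<i> * of_real b) (at_right 0)"
      by (rule Lim_transform_eventually)
    then show ?case by blast
  qed
qed

text \<open>
Since \<open>|m + i| \<ge> 1\<close>, the logarithm is a nonnegative harmonic function, and the maximum of two harmonic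
functions is supported by one of them at each point.
\<close>

lemma harmonically_supported_log:
  assumes m: "Herglotz m" and M: "M > 0"
  shows "harmonically_supported (\<lambda>z. max 0 (1 - ln (cmod (m z + \<i>)) / M))"
  unfolding harmonically_supported_def
proof (intro conjI ballI)
  have ge: "cmod (m z + \<i>) \<ge> 1" if "Im z > 0" for z
    using abs_Im_le_cmod[of "m z + \<i>"] Herglotz_Im_pos[OF m that] by simp
  have nz: "m z + \<i> \<noteq> 0" if "Im z > 0" for z using ge[OF that] by auto
  have nn: "m z + \<i> \<notin> \<real>\<^sub>\<le>\<^sub>0" if "Im z > 0" for z
    using Herglotz_Im_pos[OF m that] by (auto simp: complex_nonpos_Reals_iff)
  show "continuous_on upper_half_plane (\<lambda>z. max 0 (1 - ln (cmod (m z + \<i>)) / M))"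
    using nz M by (intro continuous_intros holomorphic_on_imp_continuous_on Herglotz_holomorphic[OF m]) auto
  show "max 0 (1 - ln (cmod (m z + \<i>)) / M) \<le> 1" if "z \<in> upper_half_plane" for z
    using ge[of z] that M by (simp add: ln_ge_zero)
  fix z0 assume z0: "z0 \<in> upper_half_plane"
  define g where "g = (\<lambda>z. 1 - Ln (m z + \<i>) / of_real M)"
  have gr: "Re (g z) = 1 - ln (cmod (m z + \<i>)) / M" if "Im z > 0" for z
    using nz[OF that] by (simp add: g_def)
  show "\<exists>g. g holomorphic_on upper_half_plane \<and>
      (\<forall>z\<in>upper_half_plane. Re (g z) \<le> max 0 (1 - ln (cmod (m z + \<i>)) / M)) \<and>
      Re (g z0) = max 0 (1 - ln (cmod (m z0 + \<i>)) / M)"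
  proof (cases "1 - ln (cmod (m z0 + \<i>)) / M \<ge> 0")
    case True
    have "g holomorphic_on upper_half_plane"
      unfolding g_def using nn M by (intro holomorphic_intros Herglotz_holomorphic[OF m]) auto
    then show ?thesis using True z0 gr by (intro exI[of _ g]) auto
  next
    case False
    then show ?thesis by (intro exI[of _ "\<lambda>_. 0"]) auto
  qed
qed simp

lemma reciprocal_filterlim_at_right: "filterlim (\<lambda>k. 1 / real (Suc k)) (at_right 0) sequentially"
  by (intro tendsto_imp_filterlim_at_right LIMSEQ_Suc lim_inverse_n'[unfolded inverse_eq_divide]) auto

text \<open>
The function \<open>F = 1 / (m + i)\<close> is bounded and has vertical limits. Where the limit is \<open>0\<close>, all the functions
\<open>v n = max 0 (1 - ln |m + i| / (n + 1))\<close> have boundary value \<open>0\<close>, although they tend to \<open>1\<close> inside the half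
plane; by the comparison principle such points form a null set.
\<close>

lemma Herglotz_boundary_value_AE:
  assumes m: "Herglotz m"
  shows "AE x in lebesgue. \<exists>l. ((\<lambda>y. m (Complex x y)) \<longlongrightarrow> l) (at_right 0)"
proof -
  define F where "F = (\<lambda>z. inverse (m z + \<i>))"
  have ge: "cmod (m z + \<i>) \<ge> 1" if "Im z > 0" for z
    using abs_Im_le_cmod[of "m z + \<i>"] Herglotz_Im_pos[OF m that] by simp
  have nz: "m z + \<i> \<noteq> 0" if "Im z > 0" for z using ge[OF that] by auto
  have "F holomorphic_on upper_half_plane"
    unfolding F_def using nz by (intro holomorphic_intros Herglotz_holomorphic[OF m]) auto
  moreover have "cmod (F z) \<le> 1" if "Im z > 0" for z
    using ge[OF that] by (simp add: F_def norm_inverse inverse_le_1_iff)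
  ultimately have lim: "AE x in lebesgue. \<exists>l. ((\<lambda>y. F (Complex x y)) \<longlongrightarrow> l) (at_right 0)"
    by (rule bounded_holomorphic_boundary_limit_AE)
  have mF: "m z = inverse (F z) - \<i>" if "Im z > 0" for z using that by (simp add: F_def)
  define v where "v = (\<lambda>n z. max 0 (1 - ln (cmod (m z + \<i>)) / real (Suc n)))"
  have hv: "harmonically_supported (v n)" for n
    unfolding v_def by (intro harmonically_supported_log m) simp
  have vF: "v n z = max 0 (1 + ln (cmod (F z)) / real (Suc n))" if "Im z > 0" for n z
    using nz[OF that] by (simp add: v_def F_def norm_inverse ln_inverse)
  have v_lim: "(\<lambda>k. v n (Complex x (1 / real (Suc k)))) \<longlonglongrightarrow>
      (if l = 0 then 0 else max 0 (1 + ln (cmod l) / real (Suc n)))"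
    if "((\<lambda>y. F (Complex x y)) \<longlongrightarrow> l) (at_right 0)" for n x l
  proof -
    have L: "(\<lambda>k. F (Complex x (1 / real (Suc k)))) \<longlonglongrightarrow> l"
      using filterlim_compose[OF that reciprocal_filterlim_at_right] by (simp add: o_def)
    have vFk: "v n (Complex x (1 / real (Suc k))) = max 0 (1 + ln (cmod (F (Complex x (1 / real (Suc k))))) / real (Suc n))" for k
      by (rule vF) simp
    show ?thesis
    proof (cases "l = 0")
      case False
      have "(\<lambda>k. max 0 (1 + ln (cmod (F (Complex x (1 / real (Suc k))))) / real (Suc n)))
          \<longlonglongrightarrow> max 0 (1 + ln (cmod l) / real (Suc n))"
        by (intro tendsto_intros L) (use False in auto)
      then show ?thesis unfolding vFk by (simp only: False if_False)
    next
      case True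
      have "(\<lambda>k. cmod (F (Complex x (1 / real (Suc k))))) \<longlonglongrightarrow> 0"
        using tendsto_norm[OF L] True by simp
      then have "eventually (\<lambda>k. cmod (F (Complex x (1 / real (Suc k)))) < exp (- real (Suc n))) sequentially"
        by (rule order_tendstoD) simp
      then have "eventually (\<lambda>k. v n (Complex x (1 / real (Suc k))) = 0) sequentially"
      proof eventually_elim
        case (elim k)
        have "cmod (F (Complex x (1 / real (Suc k)))) > 0"
          using nz[of "Complex x (1 / real (Suc k))"] by (simp add: F_def)
        then have "ln (cmod (F (Complex x (1 / real (Suc k))))) < - real (Suc n)"
          using elim by (metis exp_gt_zero ln_exp ln_less_cancel_iff)
        then have "1 + ln (cmod (F (Complex x (1 / real (Suc k))))) / real (Suc n) \<le> 0"
          by (simp add: field_simps)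
        then show ?case unfolding vFk by simp
      qed
      then show ?thesis using True by (simp add: tendsto_eventually)
    qed
  qed
  have tv: "has_vertical_trace (v n)" for n
    unfolding has_vertical_trace_def
    using lim[unfolded AE_completion_iff]
    by (rule eventually_mono) (unfold convergent_def, use v_lim in blast)
  have "AE x in lebesgue. vertical_trace (\<lambda>_. 1) x \<le> (SUP n\<in>{0..}. vertical_trace (v n) x)"
  proof (rule vertical_trace_le_sup[OF _ _ hv tv])
    show "harmonically_supported (\<lambda>_. 1)"
      unfolding harmonically_supported_def by (auto intro!: exI[of _ "\<lambda>_. 1"])
    show "has_vertical_trace (\<lambda>_. 1)" by (simp add: has_vertical_trace_def convergent_const)
    fix z :: complex assume "Im z > 0"
    have "(\<lambda>n. 1 - ln (cmod (m z + \<i>)) / real (Suc n)) \<longlonglongrightarrow> 1" by real_asymp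
    then have "(\<lambda>n. max 0 (1 - ln (cmod (m z + \<i>)) / real (Suc n))) \<longlonglongrightarrow> max 0 1"
      by (intro tendsto_max tendsto_const)
    then show "(\<lambda>n. v n z) \<longlonglongrightarrow> 1" by (simp add: v_def)
  qed
  with lim show ?thesis
  proof eventually_elim
    case (elim x)
    then obtain l where l: "((\<lambda>y. F (Complex x y)) \<longlongrightarrow> l) (at_right 0)" by blast
    have "l \<noteq> 0"
    proof
      assume "l = 0"
      then have "vertical_trace (v n) x = 0" for n using v_lim[OF l, of n] by (intro vertical_trace_eqI) auto
      moreover have "vertical_trace (\<lambda>_. 1) x = 1" by (rule vertical_trace_eqI) auto
      ultimately show False using elim(2) by simp
    qed
    have "((\<lambda>y. inverse (F (Complex x y)) - \<i>) \<longlongrightarrow> inverse l - \<i>) (at_right 0)"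
      using \<open>l \<noteq> 0\<close> by (intro tendsto_intros l)
    moreover have "eventually (\<lambda>y. inverse (F (Complex x y)) - \<i> = m (Complex x y)) (at_right 0)"
      using eventually_at_right_less[of 0] by eventually_elim (simp add: F_def)
    ultimately have "((\<lambda>y. m (Complex x y)) \<longlongrightarrow> inverse l - \<i>) (at_right 0)"
      by (rule Lim_transform_eventually)
    then show ?case by blast
  qed
qed

lemma Herglotz_add:
  assumes "Herglotz p" "Herglotz q"
  shows "Herglotz (\<lambda>z. p z + q z)"
proof (rule HerglotzI)
  show "(\<lambda>z. p z + q z) holomorphic_on upper_half_plane"
    by (intro holomorphic_on_add Herglotz_holomorphic assms)
qed (simp add: add_pos_pos Herglotz_Im_pos assms)

text \<open>
The function \<open>-1 / m\<close> is Herglotz as well, so its boundary values are finite almost everywhere.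
\<close>

lemma Herglotz_boundary_nonzero_AE:
  assumes m: "Herglotz m"
  shows "AE x in lebesgue. \<exists>l. l \<noteq> 0 \<and> ((\<lambda>y. m (Complex x y)) \<longlongrightarrow> l) (at_right 0)"
proof -
  have "Herglotz (\<lambda>z. (of_real 0 * m z + of_real (-1)) / (of_real 1 * m z + of_real 0))"
    by (rule Herglotz_moebius[OF m]) simp
  from Herglotz_boundary_value_AE[OF m] Herglotz_boundary_value_AE[OF this]
  show ?thesis
  proof eventually_elim
    case (elim x)
    then obtain l k where l: "((\<lambda>y. m (Complex x y)) \<longlongrightarrow> l) (at_right 0)"
      and k: "((\<lambda>y. - 1 / m (Complex x y)) \<longlongrightarrow> k) (at_right 0)" by auto
    have "eventually (\<lambda>y. m (Complex x y) * (- 1 / m (Complex x y)) = - 1) (at_right 0)"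
      using eventually_at_right_less[of 0]
    proof eventually_elim
      case (elim y)
      then have "m (Complex x y) \<noteq> 0" using Herglotz_Im_pos[OF m, of "Complex x y"] by auto
      then show ?case by simp
    qed
    then have "((\<lambda>y. m (Complex x y) * (- 1 / m (Complex x y))) \<longlongrightarrow> - 1) (at_right 0)"
      by (rule tendsto_eventually)
    with tendsto_mult[OF l k] have "l * k = - 1"
      using tendsto_unique trivial_limit_at_right_real by blast
    then have "l \<noteq> 0" by (metis mult_zero_left neg_equal_0_iff_equal zero_neq_one)
    then show ?case using l by blast
  qed
qed

section \<open>Semicontinuity of the reflection coefficient\<close>

definition regular_boundary_point ::
    "(complex \<Rightarrow> complex) \<Rightarrow> (complex \<Rightarrow> complex) \<Rightarrow> real \<Rightarrow> bool" where
  "regular_boundary_point p q x \<longleftrightarrow>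
     ((\<lambda>y. p (Complex x y)) \<longlongrightarrow> boundary_value p x) (at_right 0) \<and>
     ((\<lambda>y. q (Complex x y)) \<longlongrightarrow> boundary_value q x) (at_right 0) \<and>
     0 \<le> Im (boundary_value p x) \<and> 0 \<le> Im (boundary_value q x) \<and>
     boundary_value p x + boundary_value q x \<noteq> 0"

lemma boundary_value_eqI:
  "((\<lambda>y. F (Complex x y)) \<longlongrightarrow> l) (at_right 0) \<Longrightarrow> boundary_value F x = l"
  unfolding boundary_value_def by (rule tendsto_Lim) auto

lemma Herglotz_limit_Im_nonneg:
  assumes "Herglotz F" "((\<lambda>y. F (Complex x y)) \<longlongrightarrow> l) (at_right 0)"
  shows "0 \<le> Im l"
proof (rule tendsto_lowerbound[OF tendsto_Im[OF assms(2)]])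
  show "eventually (\<lambda>y. 0 \<le> Im (F (Complex x y))) (at_right 0)"
    using eventually_at_right_less[of 0]
    by eventually_elim (simp add: Herglotz_Im_pos[OF assms(1)] less_imp_le)
qed simp

lemma regular_boundary_point_AE:
  assumes p: "Herglotz p" and q: "Herglotz q"
  shows "AE x in lebesgue. regular_boundary_point p q x"
  using Herglotz_boundary_value_AE[OF p] Herglotz_boundary_value_AE[OF q]
    Herglotz_boundary_nonzero_AE[OF Herglotz_add[OF p q]]
proof eventually_elim
  case (elim x)
  then obtain P Q S where P: "((\<lambda>y. p (Complex x y)) \<longlongrightarrow> P) (at_right 0)"
    and Q: "((\<lambda>y. q (Complex x y)) \<longlongrightarrow> Q) (at_right 0)"
    and S: "((\<lambda>y. p (Complex x y) + q (Complex x y)) \<longlongrightarrow> S) (at_right 0)" "S \<noteq> 0" by blast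
  have "S = P + Q"
    using tendsto_unique[OF _ S(1) tendsto_add[OF P Q]] by simp
  then show ?case
    unfolding regular_boundary_point_def
    using P Q S(2) Herglotz_limit_Im_nonneg[OF p P] Herglotz_limit_Im_nonneg[OF q Q]
    by (simp add: boundary_value_eqI[OF P] boundary_value_eqI[OF Q])
qed

lemma abs_R_eq_refl_mod: "abs_R x (p, q) = refl_mod (boundary_value p x) (boundary_value q x)"
  by (simp add: abs_R_def R_plus_def refl_mod_def norm_divide)

lemma abs_R_bounds:
  assumes "regular_boundary_point p q x"
  shows "0 \<le> abs_R x (p, q)" "abs_R x (p, q) \<le> 1"
  using assms refl_mod_le_1 by (auto simp: abs_R_eq_refl_mod refl_mod_nonneg regular_boundary_point_def)

lemma Im_pos_add_nonzero: "Im p > 0 \<Longrightarrow> Im q > 0 \<Longrightarrow> p + q \<noteq> 0"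
  by (auto simp: complex_eq_iff)

lemma tendsto_arcsin_refl_mod:
  fixes f g :: "nat \<Rightarrow> complex"
  assumes lim: "f \<longlonglongrightarrow> P" "g \<longlonglongrightarrow> Q"
    and pos: "\<And>n. Im (f n) > 0" "\<And>n. Im (g n) > 0"
    and PQ: "P + Q \<noteq> 0" "0 \<le> Im P" "0 \<le> Im Q"
  shows "(\<lambda>n. 2 / pi * arcsin (refl_mod (f n) (g n))) \<longlonglongrightarrow> 2 / pi * arcsin (refl_mod P Q)"
proof -
  have range: "refl_mod a b \<in> {-1..1}" if "a + b \<noteq> 0" "0 \<le> Im a" "0 \<le> Im b" for a b
    using refl_mod_le_1[OF that] refl_mod_nonneg[of a b] by simp
  have "(\<lambda>n. refl_mod (f n) (g n)) \<longlonglongrightarrow> refl_mod P Q"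
    unfolding refl_mod_def by (intro tendsto_intros lim) (use PQ in simp)
  moreover have "refl_mod (f n) (g n) \<in> {-1..1}" for n
    using pos[of n] by (intro range Im_pos_add_nonzero) auto
  ultimately have "(\<lambda>n. arcsin (refl_mod (f n) (g n))) \<longlonglongrightarrow> arcsin (refl_mod P Q)"
    using range[OF PQ] by (intro continuous_on_tendsto_compose[OF continuous_on_arcsin']) auto
  then show ?thesis by (intro tendsto_mult tendsto_const)
qed

lemma refl_angle_tendsto:
  assumes p: "Herglotz p" and q: "Herglotz q" and x: "regular_boundary_point p q x"
  shows "(\<lambda>k. refl_angle p q (Complex x (1 / real (Suc k)))) \<longlonglongrightarrow> 2 / pi * arcsin (abs_R x (p, q))"
  unfolding refl_angle_def abs_R_eq_refl_mod
proof (rule tendsto_arcsin_refl_mod)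
  note lims = x[unfolded regular_boundary_point_def]
  show "(\<lambda>k. p (Complex x (1 / real (Suc k)))) \<longlonglongrightarrow> boundary_value p x"
    by (rule filterlim_compose[OF _ reciprocal_filterlim_at_right]) (use lims in blast)
  show "(\<lambda>k. q (Complex x (1 / real (Suc k)))) \<longlonglongrightarrow> boundary_value q x"
    by (rule filterlim_compose[OF _ reciprocal_filterlim_at_right]) (use lims in blast)
qed (use x Herglotz_Im_pos[OF p] Herglotz_Im_pos[OF q] in \<open>simp_all add: regular_boundary_point_def\<close>)

lemma vertical_trace_refl_angle:
  assumes "Herglotz p" "Herglotz q" "regular_boundary_point p q x"
  shows "vertical_trace (refl_angle p q) x = 2 / pi * arcsin (abs_R x (p, q))"
proof (rule vertical_trace_eqI[OF refl_angle_tendsto[OF assms]])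
  note b = abs_R_bounds[OF assms(3)]
  show "0 \<le> 2 / pi * arcsin (abs_R x (p, q))"
    using arcsin_le_arcsin[of 0 "abs_R x (p, q)"] b by simp
  show "2 / pi * arcsin (abs_R x (p, q)) \<le> 1"
    using arcsin_ubound[of "abs_R x (p, q)"] b by (simp add: field_simps)
qed

lemma has_vertical_trace_refl_angle:
  assumes "Herglotz p" "Herglotz q"
  shows "has_vertical_trace (refl_angle p q)"
  unfolding has_vertical_trace_def
  using regular_boundary_point_AE[OF assms, unfolded AE_completion_iff]
  by (rule eventually_mono) (unfold convergent_def, use refl_angle_tendsto[OF assms] in blast)

lemma refl_angle_pointwise_limit:
  assumes p: "Herglotz p" "\<And>n. Herglotz (pn n)" "(\<lambda>n. pn n z) \<longlonglongrightarrow> p z"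
    and q: "Herglotz q" "\<And>n. Herglotz (qn n)" "(\<lambda>n. qn n z) \<longlonglongrightarrow> q z"
    and z: "Im z > 0"
  shows "(\<lambda>n. refl_angle (pn n) (qn n) z) \<longlonglongrightarrow> refl_angle p q z"
  unfolding refl_angle_def
  using Herglotz_Im_pos[OF _ z] p q
  by (intro tendsto_arcsin_refl_mod Im_pos_add_nonzero less_imp_le) auto

lemma locally_uniform_limit_pointwise:
  assumes "locally_uniform_limit S f g" "z \<in> S"
  shows "(\<lambda>n. f n z) \<longlonglongrightarrow> g z"
proof -
  have "uniform_limit {z} f g sequentially"
    using assms unfolding locally_uniform_limit_def by (metis compact_sing empty_subsetI insert_subset)
  then show ?thesis by (rule tendsto_uniform_limitI) simp
qed

text \<open>
Since \<open>arcsin\<close> is strictly increasing, a tail of \<open>r\<close> below some \<open>c < a\<close> would contradict the hypothesis.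
\<close>

lemma le_limsup_if_arcsin_le_tail_sup:
  fixes r :: "nat \<Rightarrow> real"
  assumes a: "0 \<le> a" "a \<le> 1" and r: "\<And>n. 0 \<le> r n" "\<And>n. r n \<le> 1"
    and le: "\<And>N. 2 / pi * arcsin a \<le> (SUP n\<in>{N..}. 2 / pi * arcsin (r n))"
  shows "ereal a \<le> limsup (\<lambda>n. ereal (r n))"
proof (rule ccontr)
  assume "\<not> ?thesis"
  then obtain c where c: "limsup (\<lambda>n. ereal (r n)) < ereal c" "c < a"
    by (metis ereal_dense2 ereal_less_eq(3) less_ereal.simps(1) not_le)
  from Limsup_lessD[OF c(1)] obtain N where N: "\<And>n. n \<ge> N \<Longrightarrow> r n < c"
    by (auto simp: eventually_sequentially)
  have c01: "0 \<le> c" "c \<le> 1" using N[of N] r(1)[of N] a c by auto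
  have "(SUP n\<in>{N..}. 2 / pi * arcsin (r n)) \<le> 2 / pi * arcsin c"
  proof (rule cSUP_least)
    fix n assume "n \<in> {N..}"
    then have "arcsin (r n) \<le> arcsin c"
      using N[of n] r(1)[of n] c01 by (intro arcsin_le_arcsin) auto
    then show "2 / pi * arcsin (r n) \<le> 2 / pi * arcsin c" by (intro mult_left_mono) auto
  qed auto
  then have "2 / pi * arcsin a \<le> 2 / pi * arcsin c" using le[of N] by linarith
  then have "arcsin a \<le> arcsin c" by (simp add: field_simps)
  moreover have "arcsin c < arcsin a" using c(2) c01 a by (intro arcsin_less_arcsin) auto
  ultimately show False by simp
qed

theorem theorem1p2:
  fixes mp_seq mm_seq :: "nat \<Rightarrow> complex \<Rightarrow> complex"
    and mp mm :: "complex \<Rightarrow> complex"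
  assumes "\<And>n. n \<ge> 1 \<Longrightarrow> Herglotz (mp_seq n)"
    and "\<And>n. n \<ge> 1 \<Longrightarrow> Herglotz (mm_seq n)"
    and "Herglotz mp" and "Herglotz mm"
    and "locally_uniform_limit upper_half_plane mp_seq mp"
    and "locally_uniform_limit upper_half_plane mm_seq mm"
  shows "(AE x in lebesgue.
            ereal (abs_R x (mp, mm)) \<le> limsup (\<lambda>n. ereal (abs_R x (mp_seq n, mm_seq n))))
       \<and> {x. limsup (\<lambda>n. ereal (abs_R x (mp_seq n, mm_seq n))) < 1} - Sigma_ac (mp, mm)
            \<in> null_sets lebesgue"
proof -
  note H = assms(3,4)
  \<comment> \<open>The hypotheses concern indices \<open>n \<ge> 1\<close>; a shift by one leaves the limes superior unchanged.\<close>
  define pn qn where "pn n = mp_seq (Suc n)" and "qn n = mm_seq (Suc n)" for n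
  have Hn: "Herglotz (pn n)" "Herglotz (qn n)" for n
    using assms(1,2) by (auto simp: pn_def qn_def)
  have conv: "(\<lambda>n. refl_angle (pn n) (qn n) z) \<longlonglongrightarrow> refl_angle mp mm z" if "Im z > 0" for z
    using locally_uniform_limit_pointwise[OF assms(5), of z] locally_uniform_limit_pointwise[OF assms(6), of z] that
    by (intro refl_angle_pointwise_limit H Hn) (auto simp: pn_def qn_def intro: LIMSEQ_Suc)
  have "AE x in lebesgue. \<forall>N. vertical_trace (refl_angle mp mm) x \<le> (SUP n\<in>{N..}. vertical_trace (refl_angle (pn n) (qn n)) x)"
    unfolding AE_all_countable
    by (intro allI vertical_trace_le_sup harmonically_supported_refl_angle has_vertical_trace_refl_angle H Hn conv)
  moreover have "AE x in lebesgue. \<forall>n. regular_boundary_point (pn n) (qn n) x"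
    unfolding AE_all_countable by (intro allI regular_boundary_point_AE Hn)
  moreover note regular_boundary_point_AE[OF H]
  ultimately have main: "AE x in lebesgue. regular_boundary_point mp mm x \<and>
      ereal (abs_R x (mp, mm)) \<le> limsup (\<lambda>n. ereal (abs_R x (mp_seq n, mm_seq n)))"
  proof eventually_elim
    case (elim x)
    have "ereal (abs_R x (mp, mm)) \<le> limsup (\<lambda>n. ereal (abs_R x (pn n, qn n)))"
      using elim abs_R_bounds
      by (intro le_limsup_if_arcsin_le_tail_sup) (simp_all add: vertical_trace_refl_angle H Hn)
    also have "\<dots> = limsup (\<lambda>n. ereal (abs_R x (mp_seq n, mm_seq n)))"
      using limsup_shift[of "\<lambda>n. ereal (abs_R x (mp_seq n, mm_seq n))"] by (simp add: pn_def qn_def)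
    finally show ?case using elim by simp
  qed
  let ?L = "\<lambda>x. limsup (\<lambda>n. ereal (abs_R x (mp_seq n, mm_seq n)))"
  have ac: "x \<in> Sigma_ac (mp, mm)"
    if x: "regular_boundary_point mp mm x" "ereal (abs_R x (mp, mm)) \<le> ?L x" "?L x < 1" for x
  proof -
    have "abs_R x (mp, mm) < 1" using x(2,3) by (metis ereal_less(3) le_less_trans)
    moreover have nz: "boundary_value mp x + boundary_value mm x \<noteq> 0"
      using x(1) by (simp add: regular_boundary_point_def)
    ultimately have "0 < 1 - (refl_mod (boundary_value mp x) (boundary_value mm x))\<^sup>2"
      using refl_mod_nonneg by (simp add: abs_R_eq_refl_mod abs_square_less_1)
    then have "0 < Im (boundary_value mp x) * Im (boundary_value mm x)"
      unfolding refl_mod_defect[OF nz] by (simp add: zero_less_divide_iff zero_less_mult_iff)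
    then show ?thesis
      using x(1) by (auto simp: Sigma_ac_def regular_boundary_point_def zero_less_mult_iff)
  qed
  from main obtain N where N: "N \<in> null_sets lebesgue"
    "{x \<in> space lebesgue. \<not> (regular_boundary_point mp mm x \<and> ereal (abs_R x (mp, mm)) \<le> ?L x)} \<subseteq> N"
    unfolding eventually_ae_filter by blast
  have "{x. ?L x < 1} - Sigma_ac (mp, mm) \<subseteq> N" using N(2) ac by auto
  then have "{x. ?L x < 1} - Sigma_ac (mp, mm) \<in> null_sets lebesgue"
    using N(1) by (rule null_sets_completion_subset)
  moreover have "AE x in lebesgue. ereal (abs_R x (mp, mm)) \<le> ?L x"
    using main by (rule eventually_mono) blast
  ultimately show ?thesis by blast
qed

end
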